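(* Let $\bar\lambda=\langle\lambda_i: i<\kappa\rangle$ be a sequence of infinite regular cardinals, $I^*$ an ideal on $\kappa$ and $\theta$ a cardinal such that at least one of the following holds: ($\alpha$) $\min_{i<\kappa}\lambda_i>\theta\ge \mathrm{wsat}(I^* )$; or ($\beta$) $\liminf_{I^*}(\bar\lambda)\ge\theta\ge\mathrm{wsat}(I^* )$ and $(\prod\bar\lambda,\le_{I^*})$ is $\theta^+$-directed. (1) Suppose $\mathfrak c\subseteq\mathrm{pcf}(\bar\lambda)$, $\langle B_\lambda:\lambda\in\mathfrak c\rangle$ is a generating sequence for $\bar\lambda$, $B\subseteq\kappa$ and $\mathrm{pcf}(\bar\lambda\restriction B)\subseteq\mathfrak c$. Then for some finite $\mathfrak d\subseteq\mathfrak c$, $B\setminus\bigcup_{\mu\in\mathfrak d}B_\mu\in I^*$. (2) $\mathrm{cf}(\prod\bar\lambda/I^* )=\max\mathrm{pcf}(\bar\lambda)$.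
   Context: $\kappa$ is an infinite cardinal; $I^*$ is a proper ideal on $\kappa$; $\prod\bar\lambda=\prod_{i<\kappa}\lambda_i$. For an ideal $J$, $f\le_J g$ means $\{i<\kappa:\neg f(i)\le g(i)\}\in J$, similarly $<_J$; $\prod\bar\lambda/J$ is ordered accordingly; for a filter $D$ use the dual ideal. $I^+=\mathcal P(\kappa)\setminus I$. A (quasi-)partial order $P$ is $\lambda$-directed if every $A\subseteq P$ with $|A|<\lambda$ has an upper bound in $P$. $\mathrm{cf}(P)$ is the least size of a cofinal subset of $P$. $\mathrm{tcf}(P)$ is the least $\lambda$ such that there is a strictly increasing sequence $\langle p_\alpha:\alpha<\lambda\rangle$ in $P$ with every $q\in P$ below some $p_\alpha$. $\liminf_{I}(\bar\lambda)=\min\{\mu:\{i<\kappa:\lambda_i\le\mu\}\in I^+\}$. $\mathrm{wsat}(I)$ is the least cardinal $\theta$ such that $\kappa$ cannot be partitioned into $\theta$ pairwise disjoint sets each in $I^+$. $\mathrm{pcf}(\bar\lambda)=\{\mathrm{tcf}(\prod\bar\lambda/D): D$ an ultrafilter on $\kappa$ with $D\cap I^*=\emptyset\}$; $\mathrm{pcf}(\bar\lambda\restriction B)$ is the set of those $\mathrm{tcf}(\prod\bar\lambda/D)$ for which moreover $B\in D$ (empty if $B\in I^*$). $J_{<\lambda}[\bar\lambda]=\{B\subseteq\kappa:$ there is no ultrafilter $D$ on $\kappa$ with $D\cap I^*=\emptyset$, $B\in D$ and $\mathrm{tcf}(\prod\bar\lambda/D)\ge\lambda\}$, and $J_{\le\lambda}[\bar\lambda]=J_{<\lambda^+}[\bar\lambda]$.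 $\langle B_\lambda:\lambda\in\mathfrak c\rangle$ is a generating sequence for $\bar\lambda$ if $\mathfrak c\subseteq\mathrm{pcf}(\bar\lambda)$, each $B_\lambda\subseteq\kappa$, and for each $\lambda\in\mathfrak c$, $J_{\le\lambda}[\bar\lambda]$ is the ideal generated by $J_{<\lambda}[\bar\lambda]\cup\{B_\lambda\}$. *)

theory Defs
  imports Complex_Main "HOL-Library.FuncSet" "HOL-Library.Disjoint_Sets"
begin

unbundle cardinal_syntax

text \<open>
  Cardinals are relations \<open>r\<close> with \<open>Card_order r\<close>, compared across types by \<open>\<le>o\<close>, \<open><o\<close> and
  \<open>=o\<close>; ``the cardinal \<open>\<kappa>\<close> as an index set'' is \<open>Field \<kappa>\<close>. In the definitions below, \<open>K\<close> is the
  index set.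

  Quasi-orders are relations \<open>r\<close> whose carrier is \<open>Field r\<close>. Products modulo an ideal are
  quasi-orders on functions; equivalent functions are not identified.
\<close>

section \<open>Least and greatest cardinals\<close>

text \<open>
  The least element of a set \<open>S\<close> of cardinals. If \<open>S\<close> is closed under \<open>=o\<close>, then its
  \<open>\<le>o\<close>-minimal elements form one whole \<open>=o\<close>-class, so the relation chosen depends on that class
  alone, and \<open>=o\<close> between two such minima is equality (\<open>card_min_eqI\<close>). All uses
  of \<^term>\<open>card_min\<close> below are of this kind.
\<close>

definition card_min :: "'u rel set \<Rightarrow> 'u rel" where
  "card_min S = (SOME r. r \<in> S \<and> (\<forall>s\<in>S. r \<le>o s))"

definition is_card_max :: "'u rel set \<Rightarrow> 'u rel \<Rightarrow> bool" where
  "is_card_max S r \<longleftrightarrow> r \<in> S \<and> (\<forall>s\<in>S. s \<le>o r)"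

definition iso_closed :: "'u rel set \<Rightarrow> bool" where
  "iso_closed S \<longleftrightarrow> (\<forall>r\<in>S. Card_order r \<and> (\<forall>s. s =o r \<longrightarrow> s \<in> S))"

lemma card_min:
  assumes "iso_closed S" and "S \<noteq> {}"
  shows "card_min S \<in> S \<and> (\<forall>s\<in>S. card_min S \<le>o s)"
proof -
  obtain r where r: "r \<in> S" and min: "\<And>s. s <o r \<Longrightarrow> s \<notin> S"
    using wfE_min'[OF wf_ordLess assms(2)] by blast
  have co: "Card_order s" if "s \<in> S" for s
    using assms(1) that unfolding iso_closed_def by blast
  have "r \<le>o s" if s: "s \<in> S" for s
  proof (rule ccontr)
    assume "\<not> r \<le>o s"
    then have "s <o r"
      using not_ordLeq_iff_ordLess[OF card_order_on_well_order_on[OF co[OF s]]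
          card_order_on_well_order_on[OF co[OF r]]] by blast
    then show False using min s by blast
  qed
  with r have "r \<in> S \<and> (\<forall>s\<in>S. r \<le>o s)" by blast
  then show ?thesis unfolding card_min_def by (rule someI)
qed

lemma card_min_eqI:
  assumes S: "iso_closed S" "S \<noteq> {}" and T: "iso_closed T" "T \<noteq> {}"
    and iso: "card_min S =o card_min T"
  shows "card_min S = card_min T"
proof -
  have char: "(r \<in> U \<and> (\<forall>s\<in>U. r \<le>o s)) \<longleftrightarrow> r =o card_min U"
    if U: "iso_closed U" "U \<noteq> {}" for r :: "'a rel" and U
  proof
    assume "r \<in> U \<and> (\<forall>s\<in>U. r \<le>o s)"
    then show "r =o card_min U" using card_min[OF U] by (simp add: ordIso_iff_ordLeq)
  next
    assume r: "r =o card_min U"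
    then have "r \<in> U" using card_min[OF U] U(1) unfolding iso_closed_def by blast
    then show "r \<in> U \<and> (\<forall>s\<in>U. r \<le>o s)"
      using card_min[OF U] ordIso_ordLeq_trans[OF r] by blast
  qed
  have "(r \<in> S \<and> (\<forall>s\<in>S. r \<le>o s)) \<longleftrightarrow> (r \<in> T \<and> (\<forall>s\<in>T. r \<le>o s))" for r
    unfolding char[OF S] char[OF T]
    using ordIso_transitive[OF _ iso] ordIso_transitive[OF _ ordIso_symmetric[OF iso]] by blast
  then show ?thesis unfolding card_min_def by simp
qed

section \<open>Quasi-orders\<close>

definition card_directed :: "'m rel \<Rightarrow> 'p rel \<Rightarrow> bool" where
  "card_directed \<mu> r \<longleftrightarrow>
     (\<forall>A \<subseteq> Field r. |A| <o \<mu> \<longrightarrow> (\<exists>p\<in>Field r. \<forall>a\<in>A. (a, p) \<in> r))"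

text \<open>
  A cofinal subset is one in which every element has a non-strict upper bound; the constant
  \<open>cofinal\<close> of the library asks for strict upper bounds.
\<close>

definition cf :: "'p rel \<Rightarrow> 'p rel" where
  "cf r = card_min {\<mu>. Card_order \<mu> \<and>
     (\<exists>X \<subseteq> Field r. (\<forall>q\<in>Field r. \<exists>p\<in>X. (q, p) \<in> r) \<and> \<mu> =o |X| )}"

definition has_scale :: "'p rel \<Rightarrow> 'm rel \<Rightarrow> bool" where
  "has_scale r \<mu> \<longleftrightarrow> (\<exists>p. (\<forall>\<alpha>\<in>Field \<mu>. p \<alpha> \<in> Field r) \<and>
     (\<forall>\<alpha> \<beta>. (\<alpha>, \<beta>) \<in> \<mu> \<and> \<alpha> \<noteq> \<beta> \<longrightarrow> (p \<alpha>, p \<beta>) \<in> r \<and> (p \<beta>, p \<alpha>) \<notin> r) \<and>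
     (\<forall>q\<in>Field r. \<exists>\<alpha>\<in>Field \<mu>. (q, p \<alpha>) \<in> r))"

text \<open>
  Strictly increasing sequences are injective, so their lengths can be represented on the type
  of the elements. If no scale exists, the value is unspecified; this does not arise for linear
  quasi-orders such as ultraproducts.
\<close>

definition tcf :: "'p rel \<Rightarrow> 'p rel" where
  "tcf r = card_min {\<mu>. Card_order \<mu> \<and> has_scale r \<mu>}"

section \<open>Ideals, ultrafilters and reduced products\<close>

definition ideal_on :: "'k set \<Rightarrow> 'k set set \<Rightarrow> bool" where
  "ideal_on K I \<longleftrightarrow> I \<subseteq> Pow K \<and> {} \<in> I \<and>
     (\<forall>A\<in>I. \<forall>B\<subseteq>A. B \<in> I) \<and> (\<forall>A\<in>I. \<forall>B\<in>I. A \<union> B \<in> I)"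

definition proper_ideal_on :: "'k set \<Rightarrow> 'k set set \<Rightarrow> bool" where
  "proper_ideal_on K I \<longleftrightarrow> ideal_on K I \<and> K \<notin> I"

definition positive_sets :: "'k set \<Rightarrow> 'k set set \<Rightarrow> 'k set set" where
  "positive_sets K I = Pow K - I"

definition ultrafilter_on :: "'k set \<Rightarrow> 'k set set \<Rightarrow> bool" where
  "ultrafilter_on K D \<longleftrightarrow> D \<subseteq> Pow K \<and> K \<in> D \<and> {} \<notin> D \<and>
     (\<forall>A\<in>D. \<forall>B. A \<subseteq> B \<and> B \<subseteq> K \<longrightarrow> B \<in> D) \<and> (\<forall>A\<in>D. \<forall>B\<in>D. A \<inter> B \<in> D) \<and>
     (\<forall>A\<subseteq>K. A \<in> D \<or> K - A \<in> D)"

definition dual_ideal :: "'k set \<Rightarrow> 'k set set \<Rightarrow> 'k set set" where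
  "dual_ideal K D = {A. A \<subseteq> K \<and> K - A \<in> D}"

definition prod_mod :: "'k set \<Rightarrow> ('k \<Rightarrow> 'a rel) \<Rightarrow> 'k set set \<Rightarrow> ('k \<Rightarrow> 'a) rel" where
  "prod_mod K lam J = {(f, g). f \<in> (\<Pi>\<^sub>E i\<in>K. Field (lam i)) \<and> g \<in> (\<Pi>\<^sub>E i\<in>K. Field (lam i)) \<and>
     {i\<in>K. (f i, g i) \<notin> lam i} \<in> J}"

definition card_liminf :: "'k set \<Rightarrow> 'k set set \<Rightarrow> ('k \<Rightarrow> 'a rel) \<Rightarrow> 'a rel" where
  "card_liminf K I lam = card_min {\<mu>. Card_order \<mu> \<and> {i\<in>K. lam i \<le>o \<mu>} \<in> positive_sets K I}"

text \<open>
  The least nonzero cardinal is meant: a nonempty set trivially has no partition into zero parts.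
  A partition of \<open>K\<close> has at most \<open>|K|\<close> parts, so the minimum is represented on the type of sets.
\<close>

definition wsat :: "'k set \<Rightarrow> 'k set set \<Rightarrow> 'k set rel" where
  "wsat K I = card_min {\<mu>. Card_order \<mu> \<and> Field \<mu> \<noteq> {} \<and>
     \<not> (\<exists>P. partition_on K P \<and> P \<subseteq> positive_sets K I \<and> |P| =o \<mu>)}"

section \<open>Possible cofinalities\<close>

definition pcf_restrict ::
    "'k set \<Rightarrow> 'k set set \<Rightarrow> ('k \<Rightarrow> 'a rel) \<Rightarrow> 'k set \<Rightarrow> ('k \<Rightarrow> 'a) rel set" where
  "pcf_restrict K I lam B =
     {tcf (prod_mod K lam (dual_ideal K D)) |D. ultrafilter_on K D \<and> D \<inter> I = {} \<and> B \<in> D}"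

definition pcf :: "'k set \<Rightarrow> 'k set set \<Rightarrow> ('k \<Rightarrow> 'a rel) \<Rightarrow> ('k \<Rightarrow> 'a) rel set" where
  "pcf K I lam =
     {tcf (prod_mod K lam (dual_ideal K D)) |D. ultrafilter_on K D \<and> D \<inter> I = {}}"

definition J_less :: "'k set \<Rightarrow> 'k set set \<Rightarrow> ('k \<Rightarrow> 'a rel) \<Rightarrow> 'm rel \<Rightarrow> 'k set set" where
  "J_less K I lam \<mu> = {B. B \<subseteq> K \<and>
     \<not> (\<exists>D. ultrafilter_on K D \<and> D \<inter> I = {} \<and> B \<in> D \<and>
            \<mu> \<le>o tcf (prod_mod K lam (dual_ideal K D)))}"

definition J_le :: "'k set \<Rightarrow> 'k set set \<Rightarrow> ('k \<Rightarrow> 'a rel) \<Rightarrow> 'm rel \<Rightarrow> 'k set set" where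
  "J_le K I lam \<mu> = J_less K I lam (cardSuc \<mu>)"

definition generating_sequence ::
    "'k set \<Rightarrow> 'k set set \<Rightarrow> ('k \<Rightarrow> 'a rel) \<Rightarrow> ('k \<Rightarrow> 'a) rel set \<Rightarrow>
     (('k \<Rightarrow> 'a) rel \<Rightarrow> 'k set) \<Rightarrow> bool" where
  "generating_sequence K I lam c Bs \<longleftrightarrow> c \<subseteq> pcf K I lam \<and>
     (\<forall>\<mu>\<in>c. Bs \<mu> \<subseteq> K \<and> J_le K I lam \<mu> = ideal_on K hull (J_less K I lam \<mu> \<union> {Bs \<mu>}))"

end

theory Submission
  imports Defs
begin

text \<open>
  Write \<open>cof D\<close> for the true cofinality of the ultraproduct modulo an ultrafilter \<open>D\<close> that avoids
  \<open>Istar\<close>. Both hypotheses give the same three facts about \<open>\<theta>\<close> (\<open>pcf_setting\<close>): at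
  most \<open>\<theta>\<close> many functions always have a bound modulo \<open>Istar\<close>, there are no \<open>\<theta>\<close> many disjoint positive
  sets, and for each \<open>\<xi> < \<theta>\<close> almost all \<open>lam i\<close> exceed \<open>|\<xi>|\<close>. The last two forbid interleaving
  (\<open>no_interleaving\<close>): there is no function \<open>h\<close> and no sequence of length \<open>\<theta>\<close> with
  \<open>u \<xi> < h \<le> v \<xi>\<close> modulo an ultrafilter \<open>D \<xi>\<close>, in which \<open>u \<xi>\<close> is a pointwise supremum of the
  earlier \<open>v \<zeta>\<close>, because the sets of coordinates where \<open>h\<close> lies in the intervals from \<open>u \<xi>\<close> to \<open>v \<xi>\<close> would be
  positive and pairwise disjoint. It has two consequences.
  
  A family \<open>F\<close> that can be bounded modulo each of a set of ultrafilters, together with all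
  families of at most its size, has one bound that is good for all of them (\<open>uniform_bound\<close>, by
  induction on \<open>|F|\<close>). Applied to a scale of \<open>D\<close> and to the ultrafilters of larger cofinality,
  this yields a set \<open>B \<in> D\<close> that lies in no ultrafilter of cofinality above \<open>cof D\<close>
  (\<open>bounding_set\<close>). In other words, \<open>D\<close> meets \<open>J_le (cof D)\<close>.
  
  Secondly, for every cofinality \<open>\<mu>\<close> one family of \<open>\<mu>\<close> functions is cofinal modulo all
  ultrafilters of cofinality \<open>\<mu>\<close> (\<open>universal_family\<close>).
  
  What remains is compactness of the space of ultrafilters (\<open>compactness\<close>). For (1), an
  ultrafilter \<open>D\<close> containing \<open>B\<close> meets \<open>J_le (cof D)\<close> and not \<open>J_less (cof D)\<close>, hence contains the
  generator of index \<open>cof D\<close>, and so finitely many generators cover \<open>B\<close>. For (2), finitely many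
  bounding sets cover the index set, so a largest cofinality exists. The union of the
  universal families contains, for each function \<open>q\<close> and each ultrafilter, an element above \<open>q\<close>, so
  by compactness finitely many of its elements suffice for \<open>q\<close>, and their pointwise bound is above
  \<open>q\<close> modulo \<open>Istar\<close>. Closing that union under binary bounds gives a cofinal family whose size is the
  largest cofinality; conversely a family cofinal modulo \<open>Istar\<close> is cofinal modulo each ultrafilter.
\<close>

section \<open>Scales in total quasi-orders\<close>

definition dominating :: "'p set \<Rightarrow> 'p rel \<Rightarrow> bool" where
  "dominating X r \<longleftrightarrow> X \<subseteq> Field r \<and> (\<forall>q\<in>Field r. \<exists>p\<in>X. (q, p) \<in> r)"

lemma wf_strict_card: "Card_order r \<Longrightarrow> wf (r - Id)"
  by (simp add: card_order_on_def well_order_on_def)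

lemma Card_order_trichotomy:
  assumes "Card_order r" and "a \<in> Field r" and "b \<in> Field r"
  shows "(a, b) \<in> r \<or> b \<in> underS r a"
  using wo_rel.TOTALS[of r] assms
  by (auto simp: wo_rel_def underS_def card_order_on_well_order_on)

lemma has_scale_ordIso:
  assumes "has_scale r \<mu>" and "\<nu> =o \<mu>"
  shows "has_scale r \<nu>"
proof -
  obtain p where p: "\<forall>\<alpha>\<in>Field \<mu>. p \<alpha> \<in> Field r"
    "\<forall>\<alpha> \<beta>. (\<alpha>, \<beta>) \<in> \<mu> \<and> \<alpha> \<noteq> \<beta> \<longrightarrow> (p \<alpha>, p \<beta>) \<in> r \<and> (p \<beta>, p \<alpha>) \<notin> r"
    "\<forall>q\<in>Field r. \<exists>\<alpha>\<in>Field \<mu>. (q, p \<alpha>) \<in> r"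
    using assms(1) unfolding has_scale_def by blast
  obtain h where h: "iso \<nu> \<mu> h" using assms(2) unfolding ordIso_def by blast
  have bij: "bij_betw h (Field \<nu>) (Field \<mu>)"
    and mono: "\<And>a b. a \<in> Field \<nu> \<Longrightarrow> b \<in> Field \<nu> \<Longrightarrow> (a, b) \<in> \<nu> \<longleftrightarrow> (h a, h b) \<in> \<mu>"
    using h unfolding iso_iff2 by blast+
  show ?thesis unfolding has_scale_def
  proof (intro exI[of _ "p \<circ> h"] conjI ballI allI impI)
    fix a assume "a \<in> Field \<nu>"
    then show "(p \<circ> h) a \<in> Field r" using p(1) bij by (auto simp: bij_betw_def)
  next
    fix a b assume ab: "(a, b) \<in> \<nu> \<and> a \<noteq> b"
    then have F: "a \<in> Field \<nu>" "b \<in> Field \<nu>" by (auto simp: Field_def)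
    then have "h a \<noteq> h b" using ab bij by (auto simp: bij_betw_def inj_on_def)
    then show "((p \<circ> h) a, (p \<circ> h) b) \<in> r" "((p \<circ> h) b, (p \<circ> h) a) \<notin> r"
      using p(2) mono[OF F] ab by auto
  next
    fix q assume "q \<in> Field r"
    then obtain a where "a \<in> Field \<mu>" "(q, p a) \<in> r" using p(3) by blast
    then show "\<exists>\<alpha>\<in>Field \<nu>. (q, (p \<circ> h) \<alpha>) \<in> r"
      using bij unfolding bij_betw_def by (metis comp_apply imageE)
  qed
qed

locale total_quasi_order =
  fixes r :: "'p rel"
  assumes trans: "trans r"
    and total: "\<And>p q. p \<in> Field r \<Longrightarrow> q \<in> Field r \<Longrightarrow> (p, q) \<in> r \<or> (q, p) \<in> r"
    and no_top: "\<And>p. p \<in> Field r \<Longrightarrow> \<exists>q\<in>Field r. (q, p) \<notin> r"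
begin

text \<open>
  A dominating set \<open>Y\<close> of least size can be straightened into a scale along its own
  initial well-order: the values chosen so far are fewer than \<open>|Y|\<close>, so they do not dominate, and
  totality turns an element that none of them dominates into a strict upper bound.
\<close>

lemma scale_below_dominating:
  assumes "dominating X r"
  shows "\<exists>\<mu>::'p rel. Card_order \<mu> \<and> has_scale r \<mu> \<and> \<mu> \<le>o |X|"
proof -
  define S where "S = {|Y| |Y. dominating Y r}"
  have "S \<noteq> {}" using assms S_def by auto
  then obtain c where c: "c \<in> S" "\<And>d. d <o c \<Longrightarrow> d \<notin> S"
    using wfE_min'[OF wf_ordLess] by (metis (no_types, lifting))
  then obtain Y where Y: "c = |Y|" "dominating Y r" unfolding S_def by auto
  have small: "\<not> dominating Z r" if "|Z| <o |Y|" for Z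
    using c(2)[of "|Z|"] that Y(1) unfolding S_def by blast
  have YX: "|Y| \<le>o |X|"
    using small[of X] assms ordLess_or_ordLeq[OF card_of_Well_order card_of_Well_order] by blast
  define Q where "Q f y z \<longleftrightarrow> (y \<in> Y \<longrightarrow> z \<in> Field r \<and> (y, z) \<in> r \<and>
    (\<forall>x\<in>underS ( |Y| ) y. (f x, z) \<in> r \<and> (z, f x) \<notin> r))" for f y z
  have "\<exists>p. \<forall>y. Q p y (p y)"
  proof (rule dependent_wf_choice[OF wf_strict_card[OF card_of_Card_order[of Y]]])
    fix f g :: "'p \<Rightarrow> 'p" and x z
    assume "\<And>w. (w, x) \<in> |Y| - Id \<Longrightarrow> f w = g w"
    then have "\<And>w. w \<in> underS ( |Y| ) x \<Longrightarrow> f w = g w" by (auto simp: underS_def)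
    then show "Q f x z = Q g x z" unfolding Q_def by auto
  next
    fix y f
    assume IH: "\<And>w. (w, y) \<in> |Y| - Id \<Longrightarrow> Q f w (f w)"
    show "\<exists>z. Q f y z"
    proof (cases "y \<in> Y")
      case True
      let ?A = "f ` underS ( |Y| ) y"
      have sub: "?A \<subseteq> Field r"
      proof
        fix a assume "a \<in> ?A"
        then obtain w where w: "w \<in> underS ( |Y| ) y" "a = f w" by blast
        then have "w \<in> Y" by (metis Field_card_of FieldI1 underS_E)
        then show "a \<in> Field r" using IH[of w] w by (auto simp: Q_def underS_def)
      qed
      have "|?A| <o |Y|"
      proof -
        have "|?A| \<le>o |underS ( |Y| ) y|" by (rule card_of_image)
        also have "|underS ( |Y| ) y| <o |Y|"
          by (rule card_of_underS[OF card_of_Card_order]) (simp add: True Field_card_of)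
        finally show ?thesis .
      qed
      then have "\<not> dominating ?A r" by (rule small)
      then obtain q where q: "q \<in> Field r" "\<And>a. a \<in> ?A \<Longrightarrow> (q, a) \<notin> r"
        unfolding dominating_def using sub by blast
      have yF: "y \<in> Field r" using True Y(2) by (auto simp: dominating_def)
      obtain m where m: "m \<in> Field r" "(q, m) \<in> r" "(y, m) \<in> r"
        using total[OF q(1) yF] total[OF q(1) q(1)] total[OF yF yF] q(1) yF by blast
      have "(a, m) \<in> r \<and> (m, a) \<notin> r" if "a \<in> ?A" for a
      proof -
        have "(q, a) \<notin> r" and "a \<in> Field r" using q(2) that sub by auto
        then have "(a, q) \<in> r" using total[OF q(1)] by blast
        then show ?thesis using \<open>(q, a) \<notin> r\<close> m(2) trans by (meson transD)
      qed
      then show ?thesis using m unfolding Q_def by blast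
    qed (simp add: Q_def)
  qed
  then obtain p where p: "\<And>y. Q p y (p y)" by blast
  have "has_scale r |Y|" unfolding has_scale_def
  proof (intro exI[of _ p] conjI ballI allI impI)
    fix a assume "a \<in> Field |Y|"
    then show "p a \<in> Field r" using p[of a] by (simp add: Q_def Field_card_of)
  next
    fix a b assume ab: "(a, b) \<in> |Y| \<and> a \<noteq> b"
    then have "b \<in> Y" "a \<in> underS ( |Y| ) b" by (auto simp: underS_def Field_card_of dest: FieldI2)
    then show "(p a, p b) \<in> r" "(p b, p a) \<notin> r" using p[of b] by (auto simp: Q_def)
  next
    fix q assume "q \<in> Field r"
    then obtain y where "y \<in> Y" "(q, y) \<in> r" using Y(2) unfolding dominating_def by blast
    then show "\<exists>\<alpha>\<in>Field |Y|. (q, p \<alpha>) \<in> r"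
      using p[of y] trans unfolding Q_def trans_def Field_card_of by blast
  qed
  then show ?thesis using YX card_of_Card_order by blast
qed

lemma dominating_Field: "dominating (Field r) r"
  using total unfolding dominating_def by blast

lemma scale_lengths:
  shows "iso_closed {\<mu>::'p rel. Card_order \<mu> \<and> has_scale r \<mu>}"
    and "{\<mu>::'p rel. Card_order \<mu> \<and> has_scale r \<mu>} \<noteq> {}"
proof -
  show "iso_closed {\<mu>::'p rel. Card_order \<mu> \<and> has_scale r \<mu>}"
    unfolding iso_closed_def using has_scale_ordIso Card_order_ordIso by blast
  show "{\<mu>::'p rel. Card_order \<mu> \<and> has_scale r \<mu>} \<noteq> {}"
    using scale_below_dominating[OF dominating_Field] by blast
qed

lemma tcf_scale: "Card_order (tcf r)" "has_scale r (tcf r)"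
  using card_min[OF scale_lengths] unfolding tcf_def by blast+

lemma tcf_le_dominating: "dominating X r \<Longrightarrow> tcf r \<le>o |X|"
  using card_min[OF scale_lengths] scale_below_dominating ordLeq_transitive
  unfolding tcf_def by blast

end

section \<open>Products of regular cardinals and ultrafilters\<close>

text \<open>
  By Zorn's lemma. If neither \<open>A\<close> nor its complement were in a maximal ideal, then adjoining
  \<open>A\<close> would give a larger proper ideal.
\<close>

lemma maximal_ideal_extension:
  assumes "proper_ideal_on K J"
  obtains M where "proper_ideal_on K M" "J \<subseteq> M"
    "\<And>A. A \<subseteq> K \<Longrightarrow> A \<notin> M \<Longrightarrow> K - A \<in> M"
proof -
  define \<A> where "\<A> = {M. proper_ideal_on K M \<and> J \<subseteq> M}"
  have "\<A> \<noteq> {}" using assms unfolding \<A>_def by blast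
  moreover have "\<Union>C \<in> \<A>" if ne: "C \<noteq> {}" and chain: "subset.chain \<A> C" for C
  proof -
    have C: "\<And>M. M \<in> C \<Longrightarrow> proper_ideal_on K M \<and> J \<subseteq> M"
      and ch: "\<And>M N. M \<in> C \<Longrightarrow> N \<in> C \<Longrightarrow> M \<subseteq> N \<or> N \<subseteq> M"
      using chain unfolding subset_chain_def \<A>_def by blast+
    have id: "M \<subseteq> Pow K" "{} \<in> M" "K \<notin> M" "J \<subseteq> M" "\<And>A B. A \<in> M \<Longrightarrow> B \<subseteq> A \<Longrightarrow> B \<in> M"
      "\<And>A B. A \<in> M \<Longrightarrow> B \<in> M \<Longrightarrow> A \<union> B \<in> M" if "M \<in> C" for M
      using C[OF that] unfolding proper_ideal_on_def ideal_on_def by blast+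
    obtain M where "M \<in> C" using ne by blast
    have "ideal_on K (\<Union>C)" unfolding ideal_on_def
    proof (intro conjI ballI allI impI)
      fix A B assume "A \<in> \<Union>C" "B \<in> \<Union>C"
      then obtain M N where "M \<in> C" "N \<in> C" "A \<in> M" "B \<in> N" by blast
      then obtain L where "L \<in> C" "A \<in> L" "B \<in> L" using ch by blast
      then show "A \<union> B \<in> \<Union>C" using id(6) by blast
    next
      fix A B assume "A \<in> \<Union>C" "B \<subseteq> A"
      then show "B \<in> \<Union>C" using id(5) by blast
    next
      show "\<Union>C \<subseteq> Pow K" using id(1) by blast
      show "{} \<in> \<Union>C" using id(2) \<open>M \<in> C\<close> by blast
    qed
    moreover have "K \<notin> \<Union>C" using id(3) by blast
    moreover have "J \<subseteq> \<Union>C" using id(4)[OF \<open>M \<in> C\<close>] \<open>M \<in> C\<close> by blast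
    ultimately show ?thesis unfolding \<A>_def proper_ideal_on_def by simp
  qed
  ultimately obtain M where M: "M \<in> \<A>" and max: "\<And>X. X \<in> \<A> \<Longrightarrow> M \<subseteq> X \<Longrightarrow> X = M"
    using subset_Zorn_nonempty[of \<A>] by blast
  have proper: "proper_ideal_on K M" and JM: "J \<subseteq> M" using M unfolding \<A>_def by auto
  have id: "M \<subseteq> Pow K" "{} \<in> M" "\<And>A B. A \<in> M \<Longrightarrow> B \<subseteq> A \<Longrightarrow> B \<in> M"
    "\<And>A B. A \<in> M \<Longrightarrow> B \<in> M \<Longrightarrow> A \<union> B \<in> M"
    using proper unfolding proper_ideal_on_def ideal_on_def by blast+
  have "K - A \<in> M" if A: "A \<subseteq> K" "A \<notin> M" for A
  proof -
    define N where "N = {X. X \<subseteq> K \<and> (\<exists>Y\<in>M. X \<subseteq> Y \<union> A)}"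
    have NI: "X \<in> N" if "X \<subseteq> K" "Y \<in> M" "X \<subseteq> Y \<union> A" for X Y
      using that unfolding N_def by blast
    have "ideal_on K N" unfolding ideal_on_def
    proof (intro conjI ballI allI impI)
      show "{} \<in> N" using NI[OF _ id(2)] by simp
    next
      fix X Z assume "X \<in> N" "Z \<in> N"
      then obtain Y Y' where Y: "Y \<in> M" "Y' \<in> M" "X \<subseteq> Y \<union> A" "Z \<subseteq> Y' \<union> A" "X \<subseteq> K" "Z \<subseteq> K"
        unfolding N_def by blast
      show "X \<union> Z \<in> N" by (rule NI[OF _ id(4)[OF Y(1,2)]]) (use Y in blast)+
    qed (auto simp: N_def)
    moreover have MN: "M \<subseteq> N" using NI id(1) by blast
    moreover have "A \<in> N" by (rule NI[OF A(1) id(2)]) simp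
    ultimately have "\<not> proper_ideal_on K N"
      using max[of N] A(2) JM unfolding \<A>_def by auto
    with \<open>ideal_on K N\<close> have "K \<in> N" unfolding proper_ideal_on_def by simp
    then obtain Y where Y: "Y \<in> M" "K \<subseteq> Y \<union> A" unfolding N_def by blast
    then have "K - A \<subseteq> Y" by blast
    then show ?thesis using id(3)[OF Y(1)] by simp
  qed
  then show ?thesis using that proper JM by simp
qed

lemma ultrafilter_avoiding_ideal:
  assumes "proper_ideal_on K J"
  obtains D where "ultrafilter_on K D" "D \<inter> J = {}"
proof -
  obtain M where M: "proper_ideal_on K M" "J \<subseteq> M"
    and co: "\<And>A. A \<subseteq> K \<Longrightarrow> A \<notin> M \<Longrightarrow> K - A \<in> M"
    using maximal_ideal_extension[OF assms] by blast
  have id: "M \<subseteq> Pow K" "{} \<in> M" "K \<notin> M" "\<And>A B. A \<in> M \<Longrightarrow> B \<subseteq> A \<Longrightarrow> B \<in> M"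
    "\<And>A B. A \<in> M \<Longrightarrow> B \<in> M \<Longrightarrow> A \<union> B \<in> M"
    using M(1) unfolding proper_ideal_on_def ideal_on_def by blast+
  define D where "D = {A. A \<subseteq> K \<and> K - A \<in> M}"
  have "ultrafilter_on K D" unfolding ultrafilter_on_def
  proof (intro conjI ballI allI impI)
    fix A B assume "A \<in> D" "A \<subseteq> B \<and> B \<subseteq> K"
    then show "B \<in> D" using id(4)[of "K - A" "K - B"] unfolding D_def by blast
  next
    fix A B assume "A \<in> D" "B \<in> D"
    moreover have "K - A \<inter> B = (K - A) \<union> (K - B)" by blast
    ultimately show "A \<inter> B \<in> D" using id(5) unfolding D_def by auto
  next
    fix A assume "A \<subseteq> K"
    then show "A \<in> D \<or> K - A \<in> D"
      using co[of "K - A"] unfolding D_def by auto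
  qed (use id in \<open>auto simp: D_def\<close>)
  moreover have "A \<notin> J" if "A \<in> D" for A
  proof
    assume "A \<in> J"
    then have "A \<union> (K - A) \<in> M" using that M(2) id(5) unfolding D_def by blast
    moreover have "A \<union> (K - A) = K" using that unfolding D_def by blast
    ultimately show False using id(3) by simp
  qed
  ultimately show ?thesis using that by blast
qed

locale reduced_product =
  fixes K :: "'k set" and I :: "'k set set" and lam :: "'k \<Rightarrow> 'a rel"
  assumes proper: "proper_ideal_on K I"
    and factors: "\<And>i. i \<in> K \<Longrightarrow> Card_order (lam i) \<and> cinfinite (lam i) \<and> regularCard (lam i)"
begin

abbreviation P :: "('k \<Rightarrow> 'a) set" where
  "P \<equiv> \<Pi>\<^sub>E i\<in>K. Field (lam i)"

text \<open>
  All comparisons between functions go through this set: \<open>f \<le> g\<close> modulo an ultrafilter \<open>D\<close> is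
  \<open>le_set f g \<in> D\<close>, and \<open>f < g\<close> modulo \<open>D\<close> is \<open>le_set g f \<notin> D\<close>.
\<close>

definition le_set :: "('k \<Rightarrow> 'a) \<Rightarrow> ('k \<Rightarrow> 'a) \<Rightarrow> 'k set" where
  "le_set f g = {i\<in>K. (f i, g i) \<in> lam i}"

definition ult :: "'k set set \<Rightarrow> bool" where
  "ult D \<longleftrightarrow> ultrafilter_on K D \<and> D \<inter> I = {}"

abbreviation ultraproduct :: "'k set set \<Rightarrow> ('k \<Rightarrow> 'a) rel" where
  "ultraproduct D \<equiv> prod_mod K lam (dual_ideal K D)"

abbreviation cof :: "'k set set \<Rightarrow> ('k \<Rightarrow> 'a) rel" where
  "cof D \<equiv> tcf (ultraproduct D)"

lemma ideal_sub: "A \<in> I \<Longrightarrow> A \<subseteq> K"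
  and ideal_empty: "{} \<in> I"
  and ideal_top: "K \<notin> I"
  and ideal_mono: "A \<in> I \<Longrightarrow> B \<subseteq> A \<Longrightarrow> B \<in> I"
  and ideal_Un: "A \<in> I \<Longrightarrow> B \<in> I \<Longrightarrow> A \<union> B \<in> I"
  using proper unfolding proper_ideal_on_def ideal_on_def by blast+

text \<open>
  The ultrafilters avoiding \<open>I\<close> and containing \<open>C\<close> form a compact space. If no finite subfamily of
  \<open>\<B>\<close> covers \<open>C\<close> modulo \<open>I\<close>, then the sets whose part in \<open>C\<close> is so covered form a proper ideal,
  and an ultrafilter avoiding it contains \<open>C\<close> and no member of \<open>\<B>\<close>.
\<close>

lemma compactness:
  assumes "C \<subseteq> K" and meets: "\<And>D. ult D \<Longrightarrow> C \<in> D \<Longrightarrow> \<exists>B\<in>\<B>. B \<in> D"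
  shows "\<exists>\<F>\<subseteq>\<B>. finite \<F> \<and> C - \<Union>\<F> \<in> I"
proof (rule ccontr)
  assume no: "\<not> ?thesis"
  define J where "J = {X. X \<subseteq> K \<and> (\<exists>\<F>\<subseteq>\<B>. finite \<F> \<and> X \<inter> C - \<Union>\<F> \<in> I)}"
  have JI: "X \<in> J" if "X \<subseteq> K" "\<F> \<subseteq> \<B>" "finite \<F>" "X \<inter> C - \<Union>\<F> \<in> I" for X \<F>
    using that unfolding J_def by blast
  have "ideal_on K J" unfolding ideal_on_def
  proof (intro conjI ballI allI impI)
    show "J \<subseteq> Pow K" by (auto simp: J_def)
    show "{} \<in> J" using JI[of "{}" "{}"] ideal_empty by simp
  next
    fix A B assume "A \<in> J" and BA: "B \<subseteq> A"
    then obtain \<F> where F: "A \<subseteq> K" "\<F> \<subseteq> \<B>" "finite \<F>" "A \<inter> C - \<Union>\<F> \<in> I" unfolding J_def by blast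
    have "B \<inter> C - \<Union>\<F> \<in> I" by (rule ideal_mono[OF F(4)]) (use BA in blast)
    then show "B \<in> J" using JI[of B \<F>] F BA by simp
  next
    fix A B assume "A \<in> J" "B \<in> J"
    then obtain \<F> \<G> where F: "A \<subseteq> K" "\<F> \<subseteq> \<B>" "finite \<F>" "A \<inter> C - \<Union>\<F> \<in> I"
      and G: "B \<subseteq> K" "\<G> \<subseteq> \<B>" "finite \<G>" "B \<inter> C - \<Union>\<G> \<in> I" unfolding J_def by blast
    have "(A \<union> B) \<inter> C - \<Union>(\<F> \<union> \<G>) \<subseteq> (A \<inter> C - \<Union>\<F>) \<union> (B \<inter> C - \<Union>\<G>)" by blast
    then have "(A \<union> B) \<inter> C - \<Union>(\<F> \<union> \<G>) \<in> I" by (rule ideal_mono[OF ideal_Un[OF F(4) G(4)]])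
    then show "A \<union> B \<in> J" using JI[of "A \<union> B" "\<F> \<union> \<G>"] F(1-3) G(1-3) by simp
  qed
  moreover have "K \<notin> J"
  proof
    assume "K \<in> J"
    then obtain \<F> where "\<F> \<subseteq> \<B>" "finite \<F>" "K \<inter> C - \<Union>\<F> \<in> I" unfolding J_def by blast
    moreover have "K \<inter> C = C" using assms(1) by blast
    ultimately show False using no by auto
  qed
  ultimately have "proper_ideal_on K J" unfolding proper_ideal_on_def by simp
  then obtain D where D: "ultrafilter_on K D" "D \<inter> J = {}" by (rule ultrafilter_avoiding_ideal)
  have "X \<in> J" if "X \<in> I" for X
  proof (rule JI[of X "{}"])
    show "X \<subseteq> K" using that by (rule ideal_sub)
    show "X \<inter> C - \<Union>{} \<in> I" by (rule ideal_mono[OF that]) blast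
  qed auto
  then have ultD: "ult D" using D unfolding ult_def by blast
  have "(K - C) \<inter> C = {}" by blast
  then have "K - C \<in> J" using JI[of "K - C" "{}"] ideal_empty by simp
  then have CD: "C \<in> D" using D assms(1) unfolding ultrafilter_on_def by blast
  obtain B where B: "B \<in> \<B>" "B \<in> D" using meets[OF ultD CD] by blast
  have "B \<subseteq> K" using B(2) D(1) unfolding ultrafilter_on_def by blast
  moreover have "B \<inter> C - B \<in> I" by (rule ideal_mono[OF ideal_empty]) blast
  ultimately have "B \<in> J" using JI[of B "{B}"] B(1) ideal_empty by auto
  then show False using B D by blast
qed

lemma ult_rules:
  assumes "ult D"
  shows ult_sub: "A \<in> D \<Longrightarrow> A \<subseteq> K"
    and ult_mono: "A \<in> D \<Longrightarrow> A \<subseteq> B \<Longrightarrow> B \<subseteq> K \<Longrightarrow> B \<in> D"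
    and ult_Int: "A \<in> D \<Longrightarrow> B \<in> D \<Longrightarrow> A \<inter> B \<in> D"
    and ult_compl: "A \<subseteq> K \<Longrightarrow> K - A \<in> D \<longleftrightarrow> A \<notin> D"
    and ult_not_I: "A \<in> D \<Longrightarrow> A \<notin> I"
    and ult_top: "K \<in> D"
proof -
  have u: "ultrafilter_on K D" "D \<inter> I = {}" using assms unfolding ult_def by auto
  show "A \<in> D \<Longrightarrow> A \<subseteq> K" "A \<in> D \<Longrightarrow> A \<subseteq> B \<Longrightarrow> B \<subseteq> K \<Longrightarrow> B \<in> D"
    "A \<in> D \<Longrightarrow> B \<in> D \<Longrightarrow> A \<inter> B \<in> D" "A \<in> D \<Longrightarrow> A \<notin> I" "K \<in> D"
    using u unfolding ultrafilter_on_def by blast+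
  have "A \<inter> (K - A) = {}" by blast
  then show "A \<subseteq> K \<Longrightarrow> K - A \<in> D \<longleftrightarrow> A \<notin> D"
    using u(1) unfolding ultrafilter_on_def by metis
qed

lemma ult_of_co_I: "ult D \<Longrightarrow> A \<subseteq> K \<Longrightarrow> K - A \<in> I \<Longrightarrow> A \<in> D"
  using ult_not_I ult_compl by blast

lemma factor_order:
  assumes "i \<in> K"
  shows factor_refl: "x \<in> Field (lam i) \<Longrightarrow> (x, x) \<in> lam i"
    and factor_trans: "(x, y) \<in> lam i \<Longrightarrow> (y, z) \<in> lam i \<Longrightarrow> (x, z) \<in> lam i"
    and factor_total: "x \<in> Field (lam i) \<Longrightarrow> y \<in> Field (lam i) \<Longrightarrow> (x, y) \<notin> lam i \<Longrightarrow> (y, x) \<in> lam i"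
    and factor_antisym: "(x, y) \<in> lam i \<Longrightarrow> (y, x) \<in> lam i \<Longrightarrow> x = y"
proof -
  have wo: "wo_rel (lam i)"
    using factors[OF assms] by (simp add: wo_rel_def card_order_on_well_order_on)
  show "x \<in> Field (lam i) \<Longrightarrow> (x, x) \<in> lam i"
    "x \<in> Field (lam i) \<Longrightarrow> y \<in> Field (lam i) \<Longrightarrow> (x, y) \<notin> lam i \<Longrightarrow> (y, x) \<in> lam i"
    using wo_rel.TOTALS[OF wo] by blast+
  show "(x, y) \<in> lam i \<Longrightarrow> (y, z) \<in> lam i \<Longrightarrow> (x, z) \<in> lam i"
    using wo_rel.TRANS[OF wo] by (meson transD)
  show "(x, y) \<in> lam i \<Longrightarrow> (y, x) \<in> lam i \<Longrightarrow> x = y"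
    using wo_rel.ANTISYM[OF wo] by (meson antisymD)
qed

lemma factor_infinite: "i \<in> K \<Longrightarrow> finite S \<Longrightarrow> |S| <o lam i"
  using factors[of i] ordLess_ordLeq_trans[OF finite_ordLess_infinite]
  unfolding cinfinite_def
  by (metis Field_card_of card_of_Well_order card_order_on_well_order_on finite_ordLess_infinite)

lemma P_in_Field: "f \<in> P \<Longrightarrow> i \<in> K \<Longrightarrow> f i \<in> Field (lam i)"
  by auto

lemma le_set_sub: "le_set f g \<subseteq> K"
  by (auto simp: le_set_def)

lemma le_set_trans: "le_set f g \<inter> le_set g h \<subseteq> le_set f h"
  using factor_trans unfolding le_set_def by blast

lemma le_set_refl: "f \<in> P \<Longrightarrow> le_set f f = K"
  using factor_refl unfolding le_set_def by auto

lemma le_set_total: "f \<in> P \<Longrightarrow> g \<in> P \<Longrightarrow> K - le_set g f \<subseteq> le_set f g"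
  using factor_total unfolding le_set_def by blast

lemma le_trans:
  assumes "ult D" "le_set f g \<in> D" "le_set g h \<in> D"
  shows "le_set f h \<in> D"
  using ult_mono[OF assms(1) ult_Int[OF assms] le_set_trans le_set_sub] .

lemma le_total:
  assumes "ult D" "f \<in> P" "g \<in> P" "le_set g f \<notin> D"
  shows "le_set f g \<in> D"
  using ult_mono[OF assms(1) _ le_set_total[OF assms(2,3)] le_set_sub] ult_compl[OF assms(1) le_set_sub] assms(4)
  by blast

text \<open>
  Regularity of \<open>lam i\<close> gives the bound at every coordinate with more than \<open>|S|\<close> elements; at the
  other coordinates the value is arbitrary.
\<close>

lemma pointwise_bound:
  fixes f :: "'s \<Rightarrow> 'k \<Rightarrow> 'a"
  assumes "\<And>s. s \<in> S \<Longrightarrow> f s \<in> P"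
  shows "\<exists>g\<in>P. \<forall>i\<in>K. |S| <o lam i \<longrightarrow> (\<forall>s\<in>S. (f s i, g i) \<in> lam i)"
proof -
  have "\<exists>y\<in>Field (lam i). |S| <o lam i \<longrightarrow> (\<forall>s\<in>S. (f s i, y) \<in> lam i)" if i: "i \<in> K" for i
  proof (cases "|S| <o lam i")
    case True
    let ?X = "(\<lambda>s. f s i) ` S"
    have sub: "?X \<subseteq> Field (lam i)" using assms i by blast
    have "|?X| <o lam i" using ordLeq_ordLess_trans[OF card_of_image True] .
    then have "\<not> cofinal ?X (lam i)"
      using factors[OF i] sub not_ordLess_ordIso unfolding regularCard_def by blast
    then obtain y where y: "y \<in> Field (lam i)" "\<And>x. x \<in> ?X \<Longrightarrow> \<not> (y \<noteq> x \<and> (y, x) \<in> lam i)"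
      unfolding cofinal_def by blast
    have "(x, y) \<in> lam i" if "x \<in> ?X" for x
      using y that sub factor_total[OF i] factor_refl[OF i] by blast
    then show ?thesis using y(1) by blast
  next
    case False
    have "Field (lam i) \<noteq> {}" using factors[OF i] unfolding cinfinite_def by auto
    then show ?thesis using False by blast
  qed
  then obtain g where g: "\<And>i. i \<in> K \<Longrightarrow> g i \<in> Field (lam i) \<and>
      ( |S| <o lam i \<longrightarrow> (\<forall>s\<in>S. (f s i, g i) \<in> lam i))" by metis
  then show ?thesis by (intro bexI[of _ "restrict g K"]) auto
qed

lemma finite_bound:
  assumes "finite F" "F \<subseteq> P"
  shows "\<exists>g\<in>P. \<forall>f\<in>F. le_set f g = K"
proof -
  obtain g where "g \<in> P" "\<And>i f. i \<in> K \<Longrightarrow> |F| <o lam i \<Longrightarrow> f \<in> F \<Longrightarrow> (f i, g i) \<in> lam i"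
    using pointwise_bound[of F "\<lambda>f. f"] assms(2) by blast
  then show ?thesis using factor_infinite[OF _ assms(1)] unfolding le_set_def by blast
qed

lemma successor:
  assumes "f \<in> P"
  shows "\<exists>g\<in>P. le_set g f = {}"
proof -
  have "\<exists>y\<in>Field (lam i). (y, f i) \<notin> lam i" if i: "i \<in> K" for i
    using infinite_Card_order_limit[of "lam i" "f i"] factors[OF i] P_in_Field[OF assms i]
      factor_antisym[OF i] unfolding cinfinite_def by metis
  then obtain g where "\<And>i. i \<in> K \<Longrightarrow> g i \<in> Field (lam i) \<and> (g i, f i) \<notin> lam i" by metis
  then show ?thesis by (intro bexI[of _ "restrict g K"]) (auto simp: le_set_def)
qed

lemma prod_mod_iff: "(f, g) \<in> prod_mod K lam J \<longleftrightarrow> f \<in> P \<and> g \<in> P \<and> K - le_set f g \<in> J"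
proof -
  have "K - le_set f g = {i\<in>K. (f i, g i) \<notin> lam i}" unfolding le_set_def by blast
  then show ?thesis unfolding prod_mod_def by simp
qed

lemma ultraproduct_iff: "(f, g) \<in> ultraproduct D \<longleftrightarrow> f \<in> P \<and> g \<in> P \<and> le_set f g \<in> D"
proof -
  have "K - (K - le_set f g) = le_set f g" using le_set_sub by blast
  then show ?thesis unfolding prod_mod_iff dual_ideal_def by simp
qed

lemma Field_prod_mod:
  assumes "{} \<in> J"
  shows "Field (prod_mod K lam J) = P"
proof
  show "P \<subseteq> Field (prod_mod K lam J)"
  proof
    fix f assume "f \<in> P"
    then have "(f, f) \<in> prod_mod K lam J" using assms by (simp add: prod_mod_iff le_set_refl)
    then show "f \<in> Field (prod_mod K lam J)" by (rule FieldI1)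
  qed
  show "Field (prod_mod K lam J) \<subseteq> P"
  proof
    fix f assume "f \<in> Field (prod_mod K lam J)"
    then obtain g where "(f, g) \<in> prod_mod K lam J \<or> (g, f) \<in> prod_mod K lam J"
      unfolding Field_def by blast
    then show "f \<in> P" by (auto simp only: prod_mod_iff)
  qed
qed

lemma Field_ultraproduct: "ult D \<Longrightarrow> Field (ultraproduct D) = P"
  by (rule Field_prod_mod) (simp add: dual_ideal_def ult_top)

lemma ultraproduct_total_quasi_order:
  assumes "ult D"
  shows "total_quasi_order (ultraproduct D)"
proof (unfold_locales, unfold Field_ultraproduct[OF assms])
  show "trans (ultraproduct D)"
  proof (rule transI)
    fix f g h assume "(f, g) \<in> ultraproduct D" "(g, h) \<in> ultraproduct D"
    then show "(f, h) \<in> ultraproduct D" using le_trans[OF assms, of f g h] by (simp add: ultraproduct_iff)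
  qed
next
  fix f g assume "f \<in> P" "g \<in> P"
  then show "(f, g) \<in> ultraproduct D \<or> (g, f) \<in> ultraproduct D"
    using le_total[OF assms, of f g] by (auto simp: ultraproduct_iff)
next
  fix f assume "f \<in> P"
  then obtain g where g: "g \<in> P" "le_set g f = {}" using successor by metis
  have "{} \<notin> D" using ult_not_I[OF assms] ideal_empty by metis
  then show "\<exists>g\<in>P. (g, f) \<notin> ultraproduct D" using g by (intro bexI[of _ g]) (simp_all add: ultraproduct_iff)
qed

lemma strict_upper_bound:
  assumes "ult D" "p \<in> P"
  obtains q where "q \<in> P" "le_set p q \<in> D" "le_set q p \<notin> D"
proof -
  obtain q where q: "q \<in> P" "le_set q p = {}" using successor[OF assms(2)] by blast
  have "le_set q p \<notin> D" using q(2) ult_not_I[OF assms(1)] ideal_empty by metis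
  then show ?thesis using that q(1) le_total[OF assms(1,2) q(1)] by blast
qed

lemma cof_Card_order: "ult D \<Longrightarrow> Card_order (cof D)"
  using total_quasi_order.tcf_scale(1)[OF ultraproduct_total_quasi_order] .

lemma cof_scale:
  assumes "ult D"
  obtains e where "\<And>\<alpha>. \<alpha> \<in> Field (cof D) \<Longrightarrow> e \<alpha> \<in> P"
    and "\<And>\<alpha> \<beta>. (\<alpha>, \<beta>) \<in> cof D \<Longrightarrow> \<alpha> \<in> Field (cof D) \<Longrightarrow> le_set (e \<alpha>) (e \<beta>) \<in> D"
    and "\<And>q. q \<in> P \<Longrightarrow> \<exists>\<alpha>\<in>Field (cof D). le_set q (e \<alpha>) \<in> D"
proof -
  obtain e where e: "\<forall>\<alpha>\<in>Field (cof D). e \<alpha> \<in> P"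
    "\<forall>\<alpha> \<beta>. (\<alpha>, \<beta>) \<in> cof D \<and> \<alpha> \<noteq> \<beta> \<longrightarrow>
      (e \<alpha>, e \<beta>) \<in> ultraproduct D \<and> (e \<beta>, e \<alpha>) \<notin> ultraproduct D"
    "\<forall>q\<in>P. \<exists>\<alpha>\<in>Field (cof D). (q, e \<alpha>) \<in> ultraproduct D"
    using total_quasi_order.tcf_scale(2)[OF ultraproduct_total_quasi_order[OF assms]]
    unfolding has_scale_def Field_ultraproduct[OF assms] by blast
  have "le_set (e \<alpha>) (e \<beta>) \<in> D" if "(\<alpha>, \<beta>) \<in> cof D" "\<alpha> \<in> Field (cof D)" for \<alpha> \<beta>
  proof (cases "\<alpha> = \<beta>")
    case True
    then show ?thesis using le_set_refl ult_top[OF assms] e(1) that by auto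
  next
    case False
    then show ?thesis using e(2) that unfolding ultraproduct_iff by blast
  qed
  moreover have "\<exists>\<alpha>\<in>Field (cof D). le_set q (e \<alpha>) \<in> D" if "q \<in> P" for q
    using e(3) that unfolding ultraproduct_iff by blast
  ultimately show ?thesis using that e(1) by blast
qed

lemma cof_le:
  assumes "ult D" "X \<subseteq> P" "\<And>q. q \<in> P \<Longrightarrow> \<exists>p\<in>X. le_set q p \<in> D"
  shows "cof D \<le>o |X|"
proof (rule total_quasi_order.tcf_le_dominating[OF ultraproduct_total_quasi_order[OF assms(1)]])
  show "dominating X (ultraproduct D)"
    unfolding dominating_def Field_ultraproduct[OF assms(1)] ultraproduct_iff
    using assms(2,3) by blast
qed

lemma small_bounded:
  assumes "ult D" "X \<subseteq> P" "|X| <o cof D"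
  shows "\<exists>g\<in>P. \<forall>f\<in>X. le_set f g \<in> D"
proof -
  have "\<not> cof D \<le>o |X|" using assms(3) not_ordLess_ordLeq by blast
  then obtain q where "q \<in> P" "\<And>p. p \<in> X \<Longrightarrow> le_set q p \<notin> D"
    using cof_le[OF assms(1,2)] by blast
  then show ?thesis using le_total[OF assms(1)] assms(2) by blast
qed

end

section \<open>Interleaving sequences and uniform bounds\<close>

text \<open>
  What the two alternative hypotheses on \<open>\<theta>\<close> have in common.
  In \<open>small_factors\<close> the order type \<open>\<xi>\<close> is represented by its set of predecessors; the condition makes
  suprema of sequences of length \<open>\<xi>\<close> available at almost every coordinate.
\<close>

locale pcf_setting = reduced_product K I lam
  for K :: "'k set" and I :: "'k set set" and lam :: "'k \<Rightarrow> 'a rel" +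
  fixes \<theta> :: "'t rel"
  assumes theta: "Card_order \<theta>" "Field \<theta> \<noteq> {}"
    and directed: "\<And>A. A \<subseteq> P \<Longrightarrow> |A| \<le>o \<theta> \<Longrightarrow> \<exists>p\<in>P. \<forall>a\<in>A. K - le_set a p \<in> I"
    and no_disjoint: "\<And>A. (\<And>\<xi>. \<xi> \<in> Field \<theta> \<Longrightarrow> A \<xi> \<subseteq> K \<and> A \<xi> \<notin> I) \<Longrightarrow>
      disjoint_family_on A (Field \<theta>) \<Longrightarrow> False"
    and small_factors: "\<And>\<xi>. \<xi> \<in> Field \<theta> \<Longrightarrow> {i\<in>K. lam i \<le>o |underS \<theta> \<xi>| } \<in> I"
begin

definition reach :: "'t \<Rightarrow> 'k set" where
  "reach \<xi> = {i\<in>K. |underS \<theta> \<xi>| <o lam i}"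

lemma reach_ult:
  assumes "ult D" "\<xi> \<in> Field \<theta>"
  shows "reach \<xi> \<in> D"
proof (rule ult_of_co_I[OF assms(1)])
  show "reach \<xi> \<subseteq> K" by (auto simp: reach_def)
  show "K - reach \<xi> \<in> I"
  proof (rule ideal_mono[OF small_factors[OF assms(2)]])
    show "K - reach \<xi> \<subseteq> {i\<in>K. lam i \<le>o |underS \<theta> \<xi>| }"
    proof
      fix i assume i: "i \<in> K - reach \<xi>"
      then have "Well_order (lam i)" using factors card_order_on_well_order_on by blast
      then have "lam i \<le>o |underS \<theta> \<xi>|"
        using i ordLess_or_ordLeq[OF card_of_Well_order, of "lam i" "underS \<theta> \<xi>"]
        by (auto simp: reach_def)
      then show "i \<in> {i\<in>K. lam i \<le>o |underS \<theta> \<xi>| }" using i by simp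
    qed
  qed
qed

text \<open>
  At a coordinate \<open>i\<close> in two of the sets where \<open>u \<xi> < h \<le> v \<xi>\<close>, say for \<open>\<zeta> < \<xi>\<close>, one would have
  \<open>h i \<le> v \<zeta> i \<le> u \<xi> i < h i\<close>. So these sets, restricted to \<open>reach \<xi>\<close>, are disjoint, and
  each is positive because it belongs to an ultrafilter.
\<close>

lemma no_interleaving:
  assumes ult: "\<And>\<xi>. \<xi> \<in> Field \<theta> \<Longrightarrow> ult (D \<xi>)"
    and above: "\<And>\<xi>. \<xi> \<in> Field \<theta> \<Longrightarrow> le_set h (u \<xi>) \<notin> D \<xi>"
    and below: "\<And>\<xi>. \<xi> \<in> Field \<theta> \<Longrightarrow> le_set h (v \<xi>) \<in> D \<xi>"
    and vu: "\<And>\<xi> \<zeta> i. \<xi> \<in> Field \<theta> \<Longrightarrow> \<zeta> \<in> underS \<theta> \<xi> \<Longrightarrow> i \<in> reach \<xi> \<Longrightarrow> (v \<zeta> i, u \<xi> i) \<in> lam i"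
  shows False
proof -
  define A where "A \<xi> = reach \<xi> \<inter> (le_set h (v \<xi>) \<inter> (K - le_set h (u \<xi>)))" for \<xi>
  have disj: "A \<zeta> \<inter> A \<xi> = {}" if "\<xi> \<in> Field \<theta>" "\<zeta> \<in> underS \<theta> \<xi>" for \<zeta> \<xi>
  proof -
    have False if i: "i \<in> A \<zeta>" "i \<in> A \<xi>" for i
    proof -
      have iK: "i \<in> K" and hv: "(h i, v \<zeta> i) \<in> lam i" and hu: "(h i, u \<xi> i) \<notin> lam i"
        and "i \<in> reach \<xi>"
        using i by (auto simp: A_def le_set_def)
      then show False using factor_trans[OF iK hv vu] \<open>\<xi> \<in> Field \<theta>\<close> \<open>\<zeta> \<in> underS \<theta> \<xi>\<close> by simp
    qed
    then show ?thesis by blast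
  qed
  have "A \<zeta> \<inter> A \<xi> = {}" if "\<zeta> \<in> Field \<theta>" "\<xi> \<in> Field \<theta>" "\<zeta> \<noteq> \<xi>" for \<zeta> \<xi>
  proof (cases "(\<zeta>, \<xi>) \<in> \<theta>")
    case True
    then show ?thesis using disj[OF that(2)] that(3) by (simp add: underS_def)
  next
    case False
    then have "\<xi> \<in> underS \<theta> \<zeta>" using Card_order_trichotomy[OF theta(1) that(1,2)] by simp
    then show ?thesis using disj[OF that(1)] by blast
  qed
  then have "disjoint_family_on A (Field \<theta>)" by (auto simp: disjoint_family_on_def)
  moreover have "A \<xi> \<subseteq> K \<and> A \<xi> \<notin> I" if \<xi>: "\<xi> \<in> Field \<theta>" for \<xi>
  proof -
    have D: "ult (D \<xi>)" using ult[OF \<xi>] .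
    have "K - le_set h (u \<xi>) \<in> D \<xi>" using ult_compl[OF D le_set_sub] above[OF \<xi>] by blast
    then have "A \<xi> \<in> D \<xi>"
      unfolding A_def by (intro ult_Int[OF D] reach_ult[OF D \<xi>] below[OF \<xi>])
    then show ?thesis using ult_not_I[OF D] ult_sub[OF D] by blast
  qed
  ultimately show False by (rule no_disjoint[rotated])
qed

text \<open>
  The recursion that feeds \<open>no_interleaving\<close>, run simultaneously for all indices in \<open>\<Lambda>\<close>: \<open>u \<xi>\<close> is the pointwise
  supremum of the earlier functions \<open>v (x \<zeta>)\<close>, and \<open>x \<xi>\<close> is any witness for the property \<open>Q\<close> of \<open>u \<xi>\<close>.
\<close>

lemma interleaving_sequence:
  fixes \<Lambda> :: "'l set" and v :: "'x \<Rightarrow> 'l \<Rightarrow> 'k \<Rightarrow> 'a"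
  assumes ex: "\<And>u. (\<And>\<alpha>. \<alpha> \<in> \<Lambda> \<Longrightarrow> u \<alpha> \<in> P) \<Longrightarrow> \<exists>x. Q u x"
    and vP: "\<And>u x \<alpha>. Q u x \<Longrightarrow> \<alpha> \<in> \<Lambda> \<Longrightarrow> v x \<alpha> \<in> P"
  shows "\<exists>u x. \<forall>\<xi>\<in>Field \<theta>. Q (u \<xi>) (x \<xi>) \<and>
    (\<forall>\<zeta>\<in>underS \<theta> \<xi>. \<forall>\<alpha>\<in>\<Lambda>. \<forall>i\<in>reach \<xi>. (v (x \<zeta>) \<alpha> i, u \<xi> \<alpha> i) \<in> lam i)"
proof -
  define R where "R f \<xi> y \<longleftrightarrow> (\<xi> \<in> Field \<theta> \<longrightarrow> Q (fst y) (snd y) \<and>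
    (\<forall>\<zeta>\<in>underS \<theta> \<xi>. \<forall>\<alpha>\<in>\<Lambda>. \<forall>i\<in>reach \<xi>. (v (snd (f \<zeta>)) \<alpha> i, fst y \<alpha> i) \<in> lam i))"
    for f :: "'t \<Rightarrow> ('l \<Rightarrow> 'k \<Rightarrow> 'a) \<times> 'x" and \<xi> y
  have "\<exists>f. \<forall>\<xi>. R f \<xi> (f \<xi>)"
  proof (rule dependent_wf_choice[OF wf_strict_card[OF theta(1)]])
    fix f g :: "'t \<Rightarrow> ('l \<Rightarrow> 'k \<Rightarrow> 'a) \<times> 'x" and \<xi> y
    assume "\<And>\<zeta>. (\<zeta>, \<xi>) \<in> \<theta> - Id \<Longrightarrow> f \<zeta> = g \<zeta>"
    then have "\<And>\<zeta>. \<zeta> \<in> underS \<theta> \<xi> \<Longrightarrow> f \<zeta> = g \<zeta>" by (simp add: underS_def)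
    then show "R f \<xi> y = R g \<xi> y" unfolding R_def by simp
  next
    fix \<xi> and f :: "'t \<Rightarrow> ('l \<Rightarrow> 'k \<Rightarrow> 'a) \<times> 'x"
    assume IH: "\<And>\<zeta>. (\<zeta>, \<xi>) \<in> \<theta> - Id \<Longrightarrow> R f \<zeta> (f \<zeta>)"
    have "\<exists>g\<in>P. \<forall>i\<in>K. |underS \<theta> \<xi>| <o lam i \<longrightarrow> (\<forall>\<zeta>\<in>underS \<theta> \<xi>. (v (snd (f \<zeta>)) \<alpha> i, g i) \<in> lam i)"
      if \<alpha>: "\<alpha> \<in> \<Lambda>" for \<alpha>
    proof (rule pointwise_bound)
      fix \<zeta> assume "\<zeta> \<in> underS \<theta> \<xi>"
      then have "(\<zeta>, \<xi>) \<in> \<theta> - Id" by (simp add: underS_def)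
      moreover then have "\<zeta> \<in> Field \<theta>" by (auto simp: Field_def)
      ultimately have "Q (fst (f \<zeta>)) (snd (f \<zeta>))" using IH by (simp add: R_def)
      then show "v (snd (f \<zeta>)) \<alpha> \<in> P" using vP \<alpha> by blast
    qed
    then obtain u where u: "\<And>\<alpha>. \<alpha> \<in> \<Lambda> \<Longrightarrow> u \<alpha> \<in> P \<and> (\<forall>i\<in>K. |underS \<theta> \<xi>| <o lam i \<longrightarrow>
        (\<forall>\<zeta>\<in>underS \<theta> \<xi>. (v (snd (f \<zeta>)) \<alpha> i, u \<alpha> i) \<in> lam i))"
      by metis
    obtain x where "Q u x" using ex[of u] u by blast
    then have "R f \<xi> (u, x)" using u by (simp add: R_def reach_def)
    then show "\<exists>y. R f \<xi> y" ..
  qed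
  then obtain f where "\<And>\<xi>. R f \<xi> (f \<xi>)" by blast
  then show ?thesis
    by (intro exI[of _ "\<lambda>\<xi>. fst (f \<xi>)"] exI[of _ "\<lambda>\<xi>. snd (f \<xi>)"]) (simp add: R_def)
qed

lemma theta_bounded:
  assumes "A \<subseteq> P" "|A| \<le>o \<theta>"
  shows "\<exists>p\<in>P. \<forall>a\<in>A. \<forall>D. ult D \<longrightarrow> le_set a p \<in> D"
proof -
  obtain p where "p \<in> P" "\<And>a. a \<in> A \<Longrightarrow> K - le_set a p \<in> I"
    using directed[OF assms] by blast
  then show ?thesis using ult_of_co_I[OF _ le_set_sub] by blast
qed

lemma card_of_theta_image: "|f ` Field \<theta>| \<le>o \<theta>"
  using ordLeq_ordIso_trans[OF card_of_image card_of_Field_ordIso[OF theta(1)]] .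

text \<open>
  If \<open>|F| \<le> \<theta>\<close>, a bound modulo \<open>I\<close> serves. Otherwise, by induction on \<open>|F|\<close>, one may replace \<open>F\<close> by an increasing enumeration \<open>f\<close> of bounds for
  its initial segments. If the cardinal \<open>|F|\<close> is singular, a short cofinal part of \<open>f\<close> is bounded by
  induction. If it is regular and above \<open>\<theta>\<close> and no uniform bound exists, each candidate
  \<open>u \<xi>\<close> fails against some \<open>a \<xi> \<in> F\<close> and some \<open>D \<xi>\<close>, and is followed by a bound for all of \<open>f\<close> modulo
  \<open>D \<xi>\<close>. Regularity provides one index \<open>m\<close> beyond all \<open>a \<xi>\<close>, so \<open>f m\<close> interleaves.
\<close>

lemma uniform_bound:
  assumes "\<And>D. D \<in> \<D> \<Longrightarrow> ult D" and "F \<subseteq> P"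
    and "\<And>D G. D \<in> \<D> \<Longrightarrow> G \<subseteq> P \<Longrightarrow> |G| \<le>o |F| \<Longrightarrow> \<exists>g\<in>P. \<forall>f\<in>G. le_set f g \<in> D"
  shows "\<exists>g\<in>P. \<forall>D\<in>\<D>. \<forall>f\<in>F. le_set f g \<in> D"
  using assms(2,3)
proof (induction F rule: wf_induct_rule[OF wf_inv_image[OF wf_ordLess, of card_of]])
  case (1 F)
  note D = assms(1)
  have FP: "F \<subseteq> P" and bnd: "\<And>D G. D \<in> \<D> \<Longrightarrow> G \<subseteq> P \<Longrightarrow> |G| \<le>o |F| \<Longrightarrow> \<exists>g\<in>P. \<forall>f\<in>G. le_set f g \<in> D"
    by (fact 1(2), fact 1(3))
  have IH: "\<exists>g\<in>P. \<forall>D\<in>\<D>. \<forall>f\<in>G. le_set f g \<in> D" if "|G| <o |F|" "G \<subseteq> P" for G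
  proof (rule 1(1))
    show "(G, F) \<in> inv_image ordLess card_of" using that(1) by simp
    show "\<exists>g\<in>P. \<forall>f\<in>H. le_set f g \<in> D" if "D \<in> \<D>" "H \<subseteq> P" "|H| \<le>o |G|" for D H
      using bnd[OF that(1,2)] ordLeq_transitive[OF that(3) ordLess_imp_ordLeq[OF \<open>|G| <o |F|\<close>]] .
  qed (rule that(2))
  show ?case
  proof (cases "|F| \<le>o \<theta>")
    case True
    then show ?thesis using theta_bounded[OF FP] D by blast
  next
    case notle: False
    have r: "Card_order |F|" "Field |F| = F" by (rule card_of_Card_order, rule Field_card_of)
    have big: "\<theta> <o |F|"
      by (rule iffD1[OF not_ordLeq_iff_ordLess notle])
        (rule card_order_on_well_order_on[OF theta(1)], rule card_of_Well_order)
    \<comment> \<open>The value at \<open>a\<close> bounds \<open>a\<close> and all earlier values, uniformly over \<open>\<D>\<close>.\<close>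
    define Q where "Q f a z \<longleftrightarrow> (a \<in> F \<longrightarrow> z \<in> P \<and> (\<forall>D\<in>\<D>. le_set a z \<in> D \<and>
      (\<forall>g\<in>f ` underS ( |F| ) a. le_set g z \<in> D)))" for f a z
    have "\<exists>f. \<forall>a. Q f a (f a)"
    proof (rule dependent_wf_choice[OF wf_strict_card[OF r(1)]])
      fix f g :: "('k \<Rightarrow> 'a) \<Rightarrow> ('k \<Rightarrow> 'a)" and a z
      assume "\<And>b. (b, a) \<in> |F| - Id \<Longrightarrow> f b = g b"
      then have "f ` underS ( |F| ) a = g ` underS ( |F| ) a"
        by (intro image_cong refl) (simp add: underS_def)
      then show "Q f a z = Q g a z" by (simp only: Q_def)
    next
      fix a and f :: "('k \<Rightarrow> 'a) \<Rightarrow> ('k \<Rightarrow> 'a)"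
      assume pre: "\<And>b. (b, a) \<in> |F| - Id \<Longrightarrow> Q f b (f b)"
      show "\<exists>z. Q f a z"
      proof (cases "a \<in> F")
        case aF: True
        let ?G = "f ` underS ( |F| ) a"
        have "|?G| \<le>o |underS ( |F| ) a|" by (rule card_of_image)
        also have "|underS ( |F| ) a| <o |F|" by (rule card_of_underS[OF r(1)]) (simp add: r aF)
        finally have small: "|?G| <o |F|" .
        have "?G \<subseteq> P"
        proof
          fix g assume "g \<in> ?G"
          then obtain b where b: "b \<in> underS ( |F| ) a" "g = f b" by blast
          then have ba: "(b, a) \<in> |F|" "b \<noteq> a" by (simp_all add: underS_def)
          then have "b \<in> F" using FieldI1 r(2) by metis
          then show "g \<in> P" using pre[of b] ba b(2) by (simp add: Q_def)
        qed
        from IH[OF small this] obtain g where g: "g \<in> P" "\<forall>D\<in>\<D>. \<forall>h\<in>?G. le_set h g \<in> D"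
          by (rule bexE)
        have aP: "a \<in> P" using aF FP by blast
        obtain z where z: "z \<in> P" "le_set g z = K" "le_set a z = K"
          using finite_bound[of "{g, a}"] g(1) aP by auto
        have "le_set h z \<in> D" if "D \<in> \<D>" "h \<in> ?G" for D h
          using le_trans[OF D[OF that(1)] bspec[OF bspec[OF g(2) that(1)] that(2)]] z(2) ult_top[OF D[OF that(1)]] by simp
        then have "Q f a z" using z ult_top[OF D] by (simp add: Q_def)
        then show ?thesis by (rule exI[of _ z])
      qed (simp add: Q_def)
    qed
    then obtain f where f: "\<And>a. Q f a (f a)" by blast
    have fP: "f a \<in> P" and f_ge: "\<And>D. D \<in> \<D> \<Longrightarrow> le_set a (f a) \<in> D"
      and f_mono: "\<And>D b. D \<in> \<D> \<Longrightarrow> b \<in> underS ( |F| ) a \<Longrightarrow> le_set (f b) (f a) \<in> D"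
      if "a \<in> F" for a
      using f[of a] that by (simp_all add: Q_def)
    have f_le: "le_set a (f b) \<in> D" if "a \<in> F" "b \<in> F" "D \<in> \<D>" "a = b \<or> a \<in> underS ( |F| ) b" for a b D
      using le_trans[OF D[OF that(3)] f_ge[OF that(1,3)] f_mono[OF that(2,3)]] that(4)
        f_ge[OF that(1,3)] by blast
    show ?thesis
    proof (cases "regularCard ( |F| )")
      case False
      then obtain C where C: "C \<subseteq> F" "cofinal C ( |F| )" "\<not> |C| =o |F|"
        unfolding regularCard_def r(2) by blast
      have "|C| <o |F|"
        using C card_of_mono1[OF C(1)] ordLeq_iff_ordLess_or_ordIso by blast
      then have "|f ` C| <o |F|" using ordLeq_ordLess_trans[OF card_of_image] by blast
      moreover have "f ` C \<subseteq> P" using fP C(1) by blast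
      ultimately have "\<exists>g\<in>P. \<forall>D\<in>\<D>. \<forall>h\<in>f ` C. le_set h g \<in> D" by (rule IH)
      then obtain g where g: "g \<in> P" "\<forall>D\<in>\<D>. \<forall>h\<in>f ` C. le_set h g \<in> D" by (rule bexE)
      have "le_set a g \<in> D" if D': "D \<in> \<D>" and aF: "a \<in> F" for D a
      proof -
        obtain c where c: "c \<in> C" "a \<noteq> c" "(a, c) \<in> |F|"
          using C(2) aF unfolding cofinal_def r(2) by metis
        have "c \<in> F" using C(1) c(1) by (rule subsetD)
        then have "le_set a (f c) \<in> D"
          by (rule f_le[OF aF _ D']) (simp add: underS_def c)
        moreover have "le_set (f c) g \<in> D" using g(2) D' c(1) by simp
        ultimately show ?thesis by (rule le_trans[OF D[OF D']])
      qed
      then show ?thesis using g(1) by blast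
    next
      case reg: True
      show ?thesis
      proof (rule ccontr)
        assume no: "\<not> ?thesis"
        \<comment> \<open>A failure of the candidate bound \<open>u\<close>: an ultrafilter, a member of \<open>F\<close> not below \<open>u\<close>, and
          a bound \<open>w\<close> for \<open>f\<close> modulo that ultrafilter. The index set is trivial here.\<close>
        define Q' where "Q' u x \<longleftrightarrow> (case x of (D, a, w) \<Rightarrow> D \<in> \<D> \<and> a \<in> F \<and>
          le_set a (u ()) \<notin> D \<and> w \<in> P \<and> (\<forall>b\<in>F. le_set (f b) w \<in> D))"
          for u :: "unit \<Rightarrow> 'k \<Rightarrow> 'a" and x
        have "\<exists>u x. \<forall>\<xi>\<in>Field \<theta>. Q' (u \<xi>) (x \<xi>) \<and> (\<forall>\<zeta>\<in>underS \<theta> \<xi>. \<forall>\<alpha>\<in>UNIV. \<forall>i\<in>reach \<xi>.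
            (snd (snd (x \<zeta>)) i, u \<xi> \<alpha> i) \<in> lam i)"
        proof (rule interleaving_sequence[where v = "\<lambda>x _. snd (snd x)"])
          fix u :: "unit \<Rightarrow> 'k \<Rightarrow> 'a" assume "\<And>\<alpha>. \<alpha> \<in> UNIV \<Longrightarrow> u \<alpha> \<in> P"
          then obtain D a where Da: "D \<in> \<D>" "a \<in> F" "le_set a (u ()) \<notin> D" using no by blast
          have "f ` F \<subseteq> P" using fP by blast
          from bnd[OF Da(1) this card_of_image] obtain w where "w \<in> P" "\<forall>h\<in>f ` F. le_set h w \<in> D"
            by (rule bexE)
          with Da have "Q' u (D, a, w)" by (simp add: Q'_def)
          then show "\<exists>x. Q' u x" by (rule exI[of _ "(D, a, w)"])
        qed (auto simp: Q'_def)
        then obtain u x where ux: "\<And>\<xi>. \<xi> \<in> Field \<theta> \<Longrightarrow> Q' (u \<xi>) (x \<xi>)"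
          and vu: "\<And>\<xi> \<zeta> i. \<xi> \<in> Field \<theta> \<Longrightarrow> \<zeta> \<in> underS \<theta> \<xi> \<Longrightarrow> i \<in> reach \<xi> \<Longrightarrow>
            (snd (snd (x \<zeta>)) i, u \<xi> () i) \<in> lam i"
          by blast
        let ?D = "\<lambda>\<xi>. fst (x \<xi>)" and ?a = "\<lambda>\<xi>. fst (snd (x \<xi>))" and ?w = "\<lambda>\<xi>. snd (snd (x \<xi>))"
        have q: "?D \<xi> \<in> \<D>" "?a \<xi> \<in> F" "le_set (?a \<xi>) (u \<xi> ()) \<notin> ?D \<xi>"
          "\<And>b. b \<in> F \<Longrightarrow> le_set (f b) (?w \<xi>) \<in> ?D \<xi>" if "\<xi> \<in> Field \<theta>" for \<xi>
          using ux[OF that] by (auto simp: Q'_def split: prod.splits)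
        have "|?a ` Field \<theta>| <o |F|" using ordLeq_ordLess_trans[OF card_of_theta_image big] .
        moreover have aF: "?a ` Field \<theta> \<subseteq> F" using q(2) by blast
        ultimately have "\<not> cofinal (?a ` Field \<theta>) ( |F| )"
          using reg not_ordLess_ordIso unfolding regularCard_def r(2) by blast
        then obtain m where m: "m \<in> F" "\<And>\<xi>. \<xi> \<in> Field \<theta> \<Longrightarrow> \<not> (m \<noteq> ?a \<xi> \<and> (m, ?a \<xi>) \<in> |F| )"
          unfolding cofinal_def r(2) by blast
        show False
        proof (rule no_interleaving[of ?D "f m" "\<lambda>\<xi>. u \<xi> ()" ?w])
          fix \<xi> assume \<xi>: "\<xi> \<in> Field \<theta>"
          show U: "ult (?D \<xi>)" using D q(1)[OF \<xi>] .
          show "le_set (f m) (?w \<xi>) \<in> ?D \<xi>" using q(4)[OF \<xi> m(1)] .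
          have "?a \<xi> = m \<or> ?a \<xi> \<in> underS ( |F| ) m"
            using Card_order_trichotomy[of "|F|" m "?a \<xi>"] r m(1) m(2)[OF \<xi>] q(2)[OF \<xi>] by auto
          then have "le_set (?a \<xi>) (f m) \<in> ?D \<xi>" by (rule f_le[OF q(2)[OF \<xi>] m(1) q(1)[OF \<xi>]])
          then show "le_set (f m) (u \<xi> ()) \<notin> ?D \<xi>" using le_trans[OF U] q(3)[OF \<xi>] by metis
        qed (rule vu)
      qed
    qed
  qed
qed

end

section \<open>The largest cofinality and universal families\<close>

context pcf_setting
begin

lemma cof_infinite:
  assumes "ult D"
  shows "\<not> finite (Field (cof D))"
proof
  assume fin: "finite (Field (cof D))"
  obtain e where e: "\<And>\<alpha>. \<alpha> \<in> Field (cof D) \<Longrightarrow> e \<alpha> \<in> P"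
    "\<And>q. q \<in> P \<Longrightarrow> \<exists>\<alpha>\<in>Field (cof D). le_set q (e \<alpha>) \<in> D"
    using cof_scale[OF assms] by metis
  have "e ` Field (cof D) \<subseteq> P" using e(1) by blast
  then obtain g where g: "g \<in> P" "\<And>\<alpha>. \<alpha> \<in> Field (cof D) \<Longrightarrow> le_set (e \<alpha>) g = K"
    using finite_bound[of "e ` Field (cof D)"] fin by auto
  obtain q where q: "q \<in> P" "le_set q g \<notin> D" using strict_upper_bound[OF assms g(1)] by metis
  obtain \<alpha> where "\<alpha> \<in> Field (cof D)" "le_set q (e \<alpha>) \<in> D" using e(2)[OF q(1)] by blast
  then show False using le_trans[OF assms, of q "e \<alpha>" g] g(2) q(2) ult_top[OF assms] by simp
qed

text \<open>
  Let \<open>g\<close> bound a scale of \<open>D\<close> uniformly modulo all ultrafilters of cofinality above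
  \<open>cof D\<close>. Modulo \<open>D\<close> itself the scale is unbounded, so one of its members exceeds \<open>g\<close> on a set
  in \<open>D\<close>, and that set cannot be in any of those ultrafilters.
\<close>

lemma bounding_set:
  assumes "ult D"
  shows "\<exists>B\<in>D. \<forall>D'. ult D' \<and> B \<in> D' \<longrightarrow> cof D' \<le>o cof D"
proof -
  obtain e where e: "\<And>\<alpha>. \<alpha> \<in> Field (cof D) \<Longrightarrow> e \<alpha> \<in> P"
    "\<And>q. q \<in> P \<Longrightarrow> \<exists>\<alpha>\<in>Field (cof D). le_set q (e \<alpha>) \<in> D"
    using cof_scale[OF assms] by metis
  define \<D> where "\<D> = {D'. ult D' \<and> cof D <o cof D'}"
  let ?F = "e ` Field (cof D)"
  have "\<exists>g\<in>P. \<forall>D'\<in>\<D>. \<forall>f\<in>?F. le_set f g \<in> D'"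
  proof (rule uniform_bound)
    show "?F \<subseteq> P" using e(1) by blast
    show "ult D'" if "D' \<in> \<D>" for D' using that by (simp add: \<D>_def)
    show "\<exists>g\<in>P. \<forall>f\<in>G. le_set f g \<in> D'" if "D' \<in> \<D>" "G \<subseteq> P" "|G| \<le>o |?F|" for D' G
    proof (rule small_bounded)
      have "|G| \<le>o |?F|" by (rule that(3))
      also have "|?F| \<le>o |Field (cof D)|" by (rule card_of_image)
      also have "|Field (cof D)| =o cof D" by (rule card_of_Field_ordIso[OF cof_Card_order[OF assms]])
      also have "cof D <o cof D'" using that(1) by (simp add: \<D>_def)
      finally show "|G| <o cof D'" .
    qed (use that in \<open>simp_all add: \<D>_def\<close>)
  qed
  then obtain g where g: "g \<in> P" "\<forall>D'\<in>\<D>. \<forall>f\<in>?F. le_set f g \<in> D'" by (rule bexE)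
  obtain q where q: "q \<in> P" "le_set q g \<notin> D" using strict_upper_bound[OF assms g(1)] by metis
  obtain \<alpha> where \<alpha>: "\<alpha> \<in> Field (cof D)" "le_set q (e \<alpha>) \<in> D" using e(2)[OF q(1)] by blast
  have "le_set (e \<alpha>) g \<notin> D" using le_trans[OF assms \<alpha>(2)] q(2) by metis
  then have B: "K - le_set (e \<alpha>) g \<in> D" using ult_compl[OF assms le_set_sub] by metis
  have "cof D' \<le>o cof D" if D': "ult D'" and BD': "K - le_set (e \<alpha>) g \<in> D'" for D'
  proof (rule ccontr)
    assume "\<not> cof D' \<le>o cof D"
    then have "cof D <o cof D'"
      by (rule iffD1[OF not_ordLeq_iff_ordLess, rotated 2])
        (rule card_order_on_well_order_on[OF cof_Card_order[OF assms]],
          rule card_order_on_well_order_on[OF cof_Card_order[OF D']])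
    then have "D' \<in> \<D>" using D' by (simp add: \<D>_def)
    then have "le_set (e \<alpha>) g \<in> D'" using g(2) \<alpha>(1) by simp
    then show False using BD' ult_compl[OF D' le_set_sub] by metis
  qed
  then show ?thesis using B by (intro bexI[of _ "K - le_set (e \<alpha>) g"]) simp_all
qed

lemma finite_cof_max:
  assumes "finite S" "S \<noteq> {}" "\<And>D. D \<in> S \<Longrightarrow> ult D"
  shows "\<exists>M\<in>S. \<forall>D\<in>S. cof D \<le>o cof M"
  using assms
proof (induction S rule: finite_ne_induct)
  case (singleton D)
  then show ?case using ordLeq_reflexive card_order_on_well_order_on cof_Card_order by (metis singletonD singletonI)
next
  case (insert D S)
  then obtain M where M: "M \<in> S" "\<forall>D\<in>S. cof D \<le>o cof M" by auto
  have wo: "Well_order (cof D)" "Well_order (cof M)"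
    using insert.prems M(1) cof_Card_order card_order_on_well_order_on by blast+
  show ?case
  proof (cases "cof D \<le>o cof M")
    case True
    then show ?thesis using M by (intro bexI[of _ M]) simp_all
  next
    case False
    then have "cof M \<le>o cof D" using ordLeq_total[OF wo] by simp
    then have "\<forall>E\<in>S. cof E \<le>o cof D" using M(2) ordLeq_transitive by metis
    then show ?thesis using ordLeq_reflexive[OF wo(1)] by (intro bexI[of _ D]) simp_all
  qed
qed

lemma ult_finite_Union:
  assumes "ult D" "finite \<F>" "\<F> \<subseteq> Pow K" "\<Union>\<F> \<in> D"
  shows "\<exists>B\<in>\<F>. B \<in> D"
  using assms(2-4)
proof (induction \<F>)
  case empty
  then show ?case using ult_not_I[OF assms(1)] ideal_empty by auto
next
  case (insert B \<F>)
  show ?case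
  proof (cases "B \<in> D")
    case False
    then have "K - B \<in> D" using ult_compl[OF assms(1)] insert.prems by simp
    then have "(K - B) \<inter> \<Union>(insert B \<F>) \<in> D" using ult_Int[OF assms(1)] insert.prems by metis
    then have "\<Union>\<F> \<in> D" by (rule ult_mono[OF assms(1)]) (use insert.prems in auto)
    then show ?thesis using insert by auto
  qed simp
qed

lemma max_cof: "\<exists>M. ult M \<and> (\<forall>D. ult D \<longrightarrow> cof D \<le>o cof M)"
proof -
  define \<B> where "\<B> = {B. B \<subseteq> K \<and> (\<exists>D. ult D \<and> (\<forall>D'. ult D' \<and> B \<in> D' \<longrightarrow> cof D' \<le>o cof D))}"
  have "\<exists>B\<in>\<B>. B \<in> D" if D: "ult D" for D
  proof -
    obtain B where "B \<in> D" "\<forall>D'. ult D' \<and> B \<in> D' \<longrightarrow> cof D' \<le>o cof D"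
      using bounding_set[OF D] by blast
    then show ?thesis unfolding \<B>_def using D ult_sub[OF D] by blast
  qed
  then obtain \<F> where F: "\<F> \<subseteq> \<B>" "finite \<F>" "K - \<Union>\<F> \<in> I"
    using compactness[of K \<B>] by blast
  have "\<forall>B\<in>\<F>. \<exists>D. ult D \<and> (\<forall>D'. ult D' \<and> B \<in> D' \<longrightarrow> cof D' \<le>o cof D)"
    using F(1) unfolding \<B>_def by blast
  then obtain E where E: "\<And>B. B \<in> \<F> \<Longrightarrow> ult (E B)"
    "\<And>B D'. B \<in> \<F> \<Longrightarrow> ult D' \<Longrightarrow> B \<in> D' \<Longrightarrow> cof D' \<le>o cof (E B)"
    by metis
  have FK: "\<F> \<subseteq> Pow K" using F(1) unfolding \<B>_def by blast
  have cover: "\<exists>B\<in>\<F>. B \<in> D" if D: "ult D" for D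
  proof (rule ult_finite_Union[OF D F(2) FK])
    show "\<Union>\<F> \<in> D" using ult_of_co_I[OF D _ F(3)] FK by blast
  qed
  have "\<F> \<noteq> {}" using F(3) ideal_top by auto
  then obtain B where B: "B \<in> \<F>" "\<forall>C\<in>\<F>. cof (E C) \<le>o cof (E B)"
    using finite_cof_max[of "E ` \<F>"] F(2) E(1) by auto
  have "cof D \<le>o cof (E B)" if D: "ult D" for D
  proof -
    obtain C where "C \<in> \<F>" "C \<in> D" using cover[OF D] by blast
    then show ?thesis using E(2)[OF _ D] B(2) ordLeq_transitive by metis
  qed
  then show ?thesis using E(1)[OF B(1)] by blast
qed

text \<open>
  The cofinality of \<open>cof D\<close> exceeds \<open>\<theta>\<close>: \<open>\<theta>\<close> many members of a scale are bounded modulo \<open>I\<close>,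
  hence lie below one member of the scale.
\<close>

lemma theta_bounded_in_cof:
  assumes "ult D" "\<And>\<xi>. \<xi> \<in> Field \<theta> \<Longrightarrow> a \<xi> \<in> Field (cof D)"
  shows "\<exists>\<alpha>\<in>Field (cof D). \<forall>\<xi>\<in>Field \<theta>. (a \<xi>, \<alpha>) \<in> cof D"
proof -
  obtain e where e: "\<And>\<alpha>. \<alpha> \<in> Field (cof D) \<Longrightarrow> e \<alpha> \<in> P"
    "\<And>\<alpha> \<beta>. (\<alpha>, \<beta>) \<in> cof D \<Longrightarrow> \<alpha> \<in> Field (cof D) \<Longrightarrow> le_set (e \<alpha>) (e \<beta>) \<in> D"
    "\<And>q. q \<in> P \<Longrightarrow> \<exists>\<alpha>\<in>Field (cof D). le_set q (e \<alpha>) \<in> D"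
    using cof_scale[OF assms(1)] by metis
  let ?A = "(\<lambda>\<xi>. e (a \<xi>)) ` Field \<theta>"
  have "?A \<subseteq> P" using e(1)[OF assms(2)] by blast
  from theta_bounded[OF this card_of_theta_image] obtain p
    where p: "p \<in> P" "\<forall>f\<in>?A. \<forall>D. ult D \<longrightarrow> le_set f p \<in> D" by (rule bexE)
  obtain q where q: "q \<in> P" "le_set q p \<notin> D" using strict_upper_bound[OF assms(1) p(1)] by metis
  obtain \<alpha> where \<alpha>: "\<alpha> \<in> Field (cof D)" "le_set q (e \<alpha>) \<in> D" using e(3)[OF q(1)] by blast
  have "(a \<xi>, \<alpha>) \<in> cof D" if \<xi>: "\<xi> \<in> Field \<theta>" for \<xi>
  proof (rule ccontr)
    assume "(a \<xi>, \<alpha>) \<notin> cof D"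
    then have "(\<alpha>, a \<xi>) \<in> cof D"
      using Card_order_trichotomy[OF cof_Card_order[OF assms(1)] assms(2)[OF \<xi>] \<alpha>(1)]
      by (simp add: underS_def)
    then have "le_set (e \<alpha>) (e (a \<xi>)) \<in> D" using e(2) \<alpha>(1) by metis
    moreover have "le_set (e (a \<xi>)) p \<in> D" using p(2) \<xi> assms(1) by simp
    ultimately have "le_set q p \<in> D" using le_trans[OF assms(1)] \<alpha>(2) by metis
    then show False using q(2) by simp
  qed
  then show ?thesis using \<alpha>(1) by blast
qed

text \<open>
  Suppose that no family of size \<open>\<mu> = cof D0\<close> works. Then the family \<open>u \<xi>\<close>, indexed by \<open>\<mu>\<close>, of
  pointwise suprema of the earlier scales is strictly bounded by some \<open>q\<close> modulo some \<open>D \<xi>\<close> of cofinality \<open>\<mu>\<close>, and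
  a scale \<open>e\<close> of \<open>D \<xi>\<close> is the next family. With \<open>h\<close> above all these \<open>\<theta>\<close> many \<open>q\<close> modulo \<open>I\<close>, and \<open>\<alpha>\<close> so large
  that \<open>h\<close> is below the \<open>\<alpha>\<close>-th element of every one of the scales, \<open>h\<close> interleaves with the \<open>\<alpha>\<close>-th
  elements. A common \<open>\<alpha>\<close> exists since all the scales have the same length.
\<close>

lemma universal_family:
  assumes D0: "ult D0"
  shows "\<exists>F\<subseteq>P. |F| \<le>o cof D0 \<and>
    (\<forall>D. ult D \<and> cof D = cof D0 \<longrightarrow> (\<forall>q\<in>P. \<exists>f\<in>F. le_set q f \<in> D))"
proof (rule ccontr)
  assume no: "\<not> ?thesis"
  define \<mu> where "\<mu> = cof D0"
  let ?L = "Field \<mu>"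
  define Q where "Q u x \<longleftrightarrow> (case x of (D, q, e) \<Rightarrow> ult D \<and> cof D = \<mu> \<and> q \<in> P \<and>
      (\<forall>\<alpha>\<in>?L. le_set q (u \<alpha>) \<notin> D) \<and> (\<forall>\<alpha>\<in>?L. e \<alpha> \<in> P) \<and>
      (\<forall>\<alpha> \<beta>. (\<alpha>, \<beta>) \<in> \<mu> \<and> \<alpha> \<in> ?L \<longrightarrow> le_set (e \<alpha>) (e \<beta>) \<in> D) \<and>
      (\<forall>q\<in>P. \<exists>\<alpha>\<in>?L. le_set q (e \<alpha>) \<in> D))"
    for u :: "('k \<Rightarrow> 'a) \<Rightarrow> 'k \<Rightarrow> 'a" and x
  have "\<exists>u x. \<forall>\<xi>\<in>Field \<theta>. Q (u \<xi>) (x \<xi>) \<and> (\<forall>\<zeta>\<in>underS \<theta> \<xi>. \<forall>\<alpha>\<in>?L. \<forall>i\<in>reach \<xi>.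
      (snd (snd (x \<zeta>)) \<alpha> i, u \<xi> \<alpha> i) \<in> lam i)"
  proof (rule interleaving_sequence)
    fix u :: "('k \<Rightarrow> 'a) \<Rightarrow> 'k \<Rightarrow> 'a" assume u: "\<And>\<alpha>. \<alpha> \<in> ?L \<Longrightarrow> u \<alpha> \<in> P"
    have "u ` ?L \<subseteq> P" using u by blast
    moreover have "|u ` ?L| \<le>o cof D0"
      using ordLeq_ordIso_trans[OF card_of_image card_of_Field_ordIso[OF cof_Card_order[OF D0]]]
      unfolding \<mu>_def .
    ultimately have "\<not> (\<forall>D. ult D \<and> cof D = cof D0 \<longrightarrow> (\<forall>q\<in>P. \<exists>f\<in>u ` ?L. le_set q f \<in> D))"
      using no by metis
    then obtain D q where D: "ult D" "cof D = \<mu>" and q: "q \<in> P" "\<forall>\<alpha>\<in>?L. le_set q (u \<alpha>) \<notin> D"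
      unfolding \<mu>_def by auto
    obtain e where e: "\<And>\<alpha>. \<alpha> \<in> ?L \<Longrightarrow> e \<alpha> \<in> P"
      "\<And>\<alpha> \<beta>. (\<alpha>, \<beta>) \<in> \<mu> \<Longrightarrow> \<alpha> \<in> ?L \<Longrightarrow> le_set (e \<alpha>) (e \<beta>) \<in> D"
      "\<And>q. q \<in> P \<Longrightarrow> \<exists>\<alpha>\<in>?L. le_set q (e \<alpha>) \<in> D"
      using cof_scale[OF D(1)] unfolding D(2) by metis
    have "Q u (D, q, e)" using D q e by (simp add: Q_def)
    then show "\<exists>x. Q u x" by (rule exI[of _ "(D, q, e)"])
  next
    fix u \<alpha> and x :: "'k set set \<times> ('k \<Rightarrow> 'a) \<times> (('k \<Rightarrow> 'a) \<Rightarrow> 'k \<Rightarrow> 'a)"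
    assume "Q u x" "\<alpha> \<in> ?L"
    then show "snd (snd x) \<alpha> \<in> P" by (cases x) (simp add: Q_def)
  qed
  then obtain u x where ux: "\<And>\<xi>. \<xi> \<in> Field \<theta> \<Longrightarrow> Q (u \<xi>) (x \<xi>)"
    and vu: "\<And>\<xi> \<zeta> i \<alpha>. \<xi> \<in> Field \<theta> \<Longrightarrow> \<zeta> \<in> underS \<theta> \<xi> \<Longrightarrow> \<alpha> \<in> ?L \<Longrightarrow> i \<in> reach \<xi> \<Longrightarrow>
      (snd (snd (x \<zeta>)) \<alpha> i, u \<xi> \<alpha> i) \<in> lam i"
    by blast
  let ?D = "\<lambda>\<xi>. fst (x \<xi>)" and ?q = "\<lambda>\<xi>. fst (snd (x \<xi>))" and ?e = "\<lambda>\<xi>. snd (snd (x \<xi>))"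
  have x: "ult (?D \<xi>)" "?q \<xi> \<in> P" "\<And>\<alpha>. \<alpha> \<in> ?L \<Longrightarrow> le_set (?q \<xi>) (u \<xi> \<alpha>) \<notin> ?D \<xi>"
    "\<And>\<alpha> \<beta>. (\<alpha>, \<beta>) \<in> \<mu> \<Longrightarrow> \<alpha> \<in> ?L \<Longrightarrow> le_set (?e \<xi> \<alpha>) (?e \<xi> \<beta>) \<in> ?D \<xi>"
    "\<And>q. q \<in> P \<Longrightarrow> \<exists>\<alpha>\<in>?L. le_set q (?e \<xi> \<alpha>) \<in> ?D \<xi>" if "\<xi> \<in> Field \<theta>" for \<xi>
    using ux[OF that] by (simp_all add: Q_def split: prod.splits)
  have "?q ` Field \<theta> \<subseteq> P" using x(2) by blast
  from theta_bounded[OF this card_of_theta_image] obtain h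
    where h: "h \<in> P" "\<forall>f\<in>?q ` Field \<theta>. \<forall>D. ult D \<longrightarrow> le_set f h \<in> D" by (rule bexE)
  have "\<forall>\<xi>\<in>Field \<theta>. \<exists>\<alpha>\<in>?L. le_set h (?e \<xi> \<alpha>) \<in> ?D \<xi>" using x(5) h(1) by blast
  then obtain a where a: "\<And>\<xi>. \<xi> \<in> Field \<theta> \<Longrightarrow> a \<xi> \<in> ?L"
    "\<And>\<xi>. \<xi> \<in> Field \<theta> \<Longrightarrow> le_set h (?e \<xi> (a \<xi>)) \<in> ?D \<xi>" by metis
  obtain \<alpha> where \<alpha>: "\<alpha> \<in> ?L" "\<forall>\<xi>\<in>Field \<theta>. (a \<xi>, \<alpha>) \<in> \<mu>"
    using theta_bounded_in_cof[OF D0, of a] a(1) unfolding \<mu>_def by blast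
  show False
  proof (rule no_interleaving[of ?D h "\<lambda>\<xi>. u \<xi> \<alpha>" "\<lambda>\<xi>. ?e \<xi> \<alpha>"])
    fix \<xi> assume \<xi>: "\<xi> \<in> Field \<theta>"
    show U: "ult (?D \<xi>)" by (rule x(1)[OF \<xi>])
    have "le_set (?q \<xi>) h \<in> ?D \<xi>" using h(2) \<xi> U by simp
    then show "le_set h (u \<xi> \<alpha>) \<notin> ?D \<xi>" using le_trans[OF U] x(3)[OF \<xi> \<alpha>(1)] by metis
    have "(a \<xi>, \<alpha>) \<in> \<mu>" using \<alpha>(2) \<xi> by simp
    then show "le_set h (?e \<xi> \<alpha>) \<in> ?D \<xi>"
      by (rule le_trans[OF U a(2)[OF \<xi>] x(4)[OF \<xi> _ a(1)[OF \<xi>]]])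
  next
    fix \<xi> \<zeta> i assume "\<xi> \<in> Field \<theta>" "\<zeta> \<in> underS \<theta> \<xi>" "i \<in> reach \<xi>"
    then show "(?e \<zeta> \<alpha> i, u \<xi> \<alpha> i) \<in> lam i" by (intro vu \<alpha>(1))
  qed
qed

end

section \<open>Counting cardinals and cofinal families\<close>

lemma card_of_closure_le:
  fixes M :: "'m rel" and m :: "'p \<Rightarrow> 'p \<Rightarrow> 'p"
  assumes M: "Card_order M" "\<not> finite (Field M)" and G: "|G| \<le>o M" "G \<subseteq> P"
    and m: "\<And>x y. x \<in> P \<Longrightarrow> y \<in> P \<Longrightarrow> m x y \<in> P"
  shows "\<exists>H. G \<subseteq> H \<and> H \<subseteq> P \<and> |H| \<le>o M \<and> (\<forall>x\<in>H. \<forall>y\<in>H. m x y \<in> H)"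
proof -
  define step where "step X = X \<union> case_prod m ` (X \<times> X)" for X
  define L where "L n = (step ^^ n) G" for n
  have L0: "L 0 = G" and LS: "L (Suc n) = step (L n)" for n by (simp_all add: L_def)
  have card: "|L n| \<le>o M" for n
  proof (induction n)
    case (Suc n)
    have "|case_prod m ` (L n \<times> L n)| \<le>o M"
      using ordLeq_transitive[OF card_of_image]
        card_of_Times_ordLeq_infinite_Field[OF M(2) Suc Suc M(1)] by blast
    then show ?case unfolding LS step_def
      using card_of_Un_ordLeq_infinite_Field[OF M(2) Suc _ M(1)] by blast
  qed (simp add: L0 G)
  have P: "L n \<subseteq> P" for n
  proof (induction n)
    case (Suc n)
    have "m x y \<in> P" if "x \<in> L n" "y \<in> L n" for x y using m that Suc by blast
    then show ?case using Suc by (auto simp: LS step_def)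
  qed (simp add: L0 G)
  have mono: "L n \<subseteq> L k" if "n \<le> k" for n k
    using that by (induction rule: dec_induct) (auto simp: LS step_def)
  have "|UNIV :: nat set| \<le>o M"
    using infinite_iff_card_of_nat M card_of_Field_ordIso ordLeq_ordIso_trans by blast
  then have "|\<Union>n. L n| \<le>o M"
    using card_of_UNION_ordLeq_infinite_Field[OF M(2) M(1)] card by blast
  moreover have "m x y \<in> (\<Union>n. L n)" if xy: "x \<in> (\<Union>n. L n)" "y \<in> (\<Union>n. L n)" for x y
  proof -
    obtain n k where "x \<in> L n" "y \<in> L k" using xy by blast
    then have "x \<in> L (max n k)" "y \<in> L (max n k)" using mono by (meson max.cobounded1 max.cobounded2 subsetD)+
    then have "m x y \<in> L (Suc (max n k))" by (auto simp: LS step_def)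
    then show ?thesis by blast
  qed
  ultimately show ?thesis using L0 P by (intro exI[of _ "\<Union>n. L n"]) blast
qed

text \<open>
  A cardinal below \<open>M\<close> is the order type of an initial segment of \<open>M\<close>, determined by the element
  of \<open>M\<close> that bounds it.
\<close>

lemma card_of_cardinals_le:
  fixes S :: "'p rel set"
  assumes S: "\<And>\<mu>. \<mu> \<in> S \<Longrightarrow> Card_order \<mu> \<and> \<mu> \<le>o M"
    and eq: "\<And>\<mu> \<nu>. \<mu> \<in> S \<Longrightarrow> \<nu> \<in> S \<Longrightarrow> \<mu> =o \<nu> \<Longrightarrow> \<mu> = \<nu>"
    and M: "Card_order M" "\<not> finite (Field M)"
  shows "|S| \<le>o M"
proof -
  have wM: "Well_order M" using M(1) card_order_on_well_order_on by blast
  define T where "T = {\<mu>\<in>S. \<mu> <o M}"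
  have "\<forall>\<mu>\<in>T. \<exists>a\<in>Field M. \<mu> =o Restr M (underS M a)"
  proof
    fix \<mu> assume "\<mu> \<in> T"
    then have "\<mu> <o M" and "Well_order \<mu>"
      using S card_order_on_well_order_on by (auto simp: T_def)
    then show "\<exists>a\<in>Field M. \<mu> =o Restr M (underS M a)"
      using ordLess_iff_ordIso_Restr[OF wM] by blast
  qed
  then obtain a where a: "\<And>\<mu>. \<mu> \<in> T \<Longrightarrow> a \<mu> \<in> Field M"
    "\<And>\<mu>. \<mu> \<in> T \<Longrightarrow> \<mu> =o Restr M (underS M (a \<mu>))" by metis
  have "inj_on a T"
  proof (rule inj_onI)
    fix \<mu> \<nu> assume T: "\<mu> \<in> T" "\<nu> \<in> T" and e: "a \<mu> = a \<nu>"
    have "\<mu> =o \<nu>"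
      using ordIso_transitive[OF a(2)[OF T(1), unfolded e] ordIso_symmetric[OF a(2)[OF T(2)]]] .
    then show "\<mu> = \<nu>" using eq T by (simp add: T_def)
  qed
  then have "|T| \<le>o |Field M|" using a(1) card_of_ordLeqI by metis
  then have "|T| \<le>o M" using card_of_Field_ordIso[OF M(1)] ordLeq_ordIso_trans by blast
  moreover have "|S - T| \<le>o M"
  proof -
    have "\<mu> = \<nu>" if "\<mu> \<in> S - T" "\<nu> \<in> S - T" for \<mu> \<nu>
    proof -
      have "\<rho> =o M" if "\<rho> \<in> S - T" for \<rho>
        using that S[of \<rho>] ordLeq_iff_ordLess_or_ordIso by (auto simp: T_def)
      then have "\<mu> =o \<nu>" using that ordIso_symmetric ordIso_transitive by blast
      then show ?thesis using eq that by simp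
    qed
    then have "finite (S - T)"
      by (metis (no_types, lifting) finite.simps finite_subset insertI1 subsetI)
    moreover have "|Field M| =o M" by (rule card_of_Field_ordIso[OF M(1)])
    ultimately have "|S - T| <o |Field M|"
      using M(2) by (intro finite_ordLess_infinite) (simp_all add: Field_card_of card_of_well_order_on)
    then show ?thesis
      using ordLess_imp_ordLeq ordLeq_ordIso_trans[OF _ \<open>|Field M| =o M\<close>] by blast
  qed
  ultimately have "|T \<union> (S - T)| \<le>o M"
    by (rule card_of_Un_ordLeq_infinite_Field[OF M(2) _ _ M(1)])
  moreover have "T \<union> (S - T) = S" by (auto simp: T_def)
  ultimately show ?thesis by simp
qed

lemma cf_candidates:
  fixes r :: "'p rel"
  assumes "dominating Y r"
  defines "C \<equiv> {\<mu>::'p rel. Card_order \<mu> \<and> (\<exists>X \<subseteq> Field r. (\<forall>q\<in>Field r. \<exists>p\<in>X. (q, p) \<in> r) \<and> \<mu> =o |X| )}"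
  shows "iso_closed C" and "C \<noteq> {}" and "cf r \<le>o |Y|"
    and "\<exists>X. dominating X r \<and> cf r =o |X|"
proof -
  show iso: "iso_closed C"
    unfolding iso_closed_def C_def using Card_order_ordIso ordIso_transitive by blast
  have Y: "|Y| \<in> C"
    using assms(1) card_of_Card_order card_of_refl unfolding C_def dominating_def by blast
  then show ne: "C \<noteq> {}" by blast
  show "cf r \<le>o |Y|" using card_min[OF iso ne] Y unfolding cf_def C_def by blast
  have "cf r \<in> C" using card_min[OF iso ne] unfolding cf_def C_def by blast
  then show "\<exists>X. dominating X r \<and> cf r =o |X|" unfolding C_def dominating_def by blast
qed

section \<open>The cofinality of the reduced product and covers by generators\<close>

context pcf_setting
begin

lemma pcf_iff: "\<mu> \<in> pcf K I lam \<longleftrightarrow> (\<exists>D. ult D \<and> \<mu> = cof D)"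
  unfolding pcf_def ult_def by blast

lemma cof_eqI:
  assumes "ult D" "ult E" "cof D =o cof E"
  shows "cof D = cof E"
  using assms(3) unfolding tcf_def
  by (intro card_min_eqI total_quasi_order.scale_lengths ultraproduct_total_quasi_order assms(1,2))

lemma dominating_prod_iff:
  "dominating X (prod_mod K lam I) \<longleftrightarrow>
    X \<subseteq> P \<and> (\<forall>q\<in>P. \<exists>f\<in>X. K - le_set q f \<in> I)"
  unfolding dominating_def Field_prod_mod[OF ideal_empty] prod_mod_iff by blast

lemma dominating_ult:
  assumes "dominating X (prod_mod K lam I)" "ult D"
  shows "cof D \<le>o |X|"
proof (rule cof_le[OF assms(2)])
  show "X \<subseteq> P" using assms(1) by (simp only: dominating_prod_iff)
  fix q assume "q \<in> P"
  then obtain f where "f \<in> X" "K - le_set q f \<in> I"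
    using assms(1) unfolding dominating_prod_iff by blast
  then show "\<exists>f\<in>X. le_set q f \<in> D" using ult_of_co_I[OF assms(2) le_set_sub] by blast
qed

text \<open>
  The family is the closure under the binary bound \<open>m\<close> of the union of universal
  families for all possible cofinalities. There are at most \<open>cof M\<close> of these, so the
  union has size at most \<open>cof M\<close>.
\<close>

lemma dominating_small:
  assumes M: "ult M" "\<And>D. ult D \<Longrightarrow> cof D \<le>o cof M"
  shows "\<exists>X. dominating X (prod_mod K lam I) \<and> |X| \<le>o cof M"
proof -
  let ?S = "pcf K I lam"
  have co: "Card_order (cof M)" and inf: "\<not> finite (Field (cof M))"
    using cof_Card_order[OF M(1)] cof_infinite[OF M(1)] by blast+
  have card: "|?S| \<le>o cof M"
  proof (rule card_of_cardinals_le[OF _ _ co inf])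
    show "Card_order \<mu> \<and> \<mu> \<le>o cof M" if "\<mu> \<in> ?S" for \<mu>
      using that M(2) cof_Card_order unfolding pcf_iff by blast
    show "\<mu> = \<nu>" if "\<mu> \<in> ?S" "\<nu> \<in> ?S" "\<mu> =o \<nu>" for \<mu> \<nu>
      using that cof_eqI unfolding pcf_iff by metis
  qed
  have "\<forall>\<mu>\<in>?S. \<exists>F\<subseteq>P. |F| \<le>o \<mu> \<and> (\<forall>D. ult D \<and> cof D = \<mu> \<longrightarrow> (\<forall>q\<in>P. \<exists>f\<in>F. le_set q f \<in> D))"
  proof
    fix \<mu> assume "\<mu> \<in> ?S"
    then obtain D where D: "ult D" "\<mu> = cof D" unfolding pcf_iff by blast
    show "\<exists>F\<subseteq>P. |F| \<le>o \<mu> \<and> (\<forall>D. ult D \<and> cof D = \<mu> \<longrightarrow> (\<forall>q\<in>P. \<exists>f\<in>F. le_set q f \<in> D))"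
      unfolding D(2) by (rule universal_family[OF D(1)])
  qed
  then obtain F where F: "\<And>\<mu>. \<mu> \<in> ?S \<Longrightarrow> F \<mu> \<subseteq> P" "\<And>\<mu>. \<mu> \<in> ?S \<Longrightarrow> |F \<mu>| \<le>o \<mu>"
    "\<And>\<mu> D q. \<mu> \<in> ?S \<Longrightarrow> ult D \<Longrightarrow> cof D = \<mu> \<Longrightarrow> q \<in> P \<Longrightarrow> \<exists>f\<in>F \<mu>. le_set q f \<in> D"
    by metis
  define G where "G = (\<Union>\<mu>\<in>?S. F \<mu>)"
  have GP: "G \<subseteq> P" using F(1) unfolding G_def by blast
  have "|F \<mu>| \<le>o cof M" if \<mu>: "\<mu> \<in> ?S" for \<mu>
  proof -
    obtain D where "ult D" "\<mu> = cof D" using \<mu> unfolding pcf_iff by blast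
    then show ?thesis using ordLeq_transitive[OF F(2)[OF \<mu>]] M(2) by metis
  qed
  then have "|G| \<le>o cof M"
    unfolding G_def by (intro card_of_UNION_ordLeq_infinite_Field[OF inf co card] ballI)
  have "\<exists>m. f \<in> P \<longrightarrow> g \<in> P \<longrightarrow> m \<in> P \<and> le_set f m = K \<and> le_set g m = K" for f g
  proof (cases "f \<in> P \<and> g \<in> P")
    case True
    then show ?thesis using finite_bound[of "{f, g}"] by auto
  qed blast
  then obtain m where m: "\<And>f g. f \<in> P \<Longrightarrow> g \<in> P \<Longrightarrow> m f g \<in> P"
    "\<And>f g. f \<in> P \<Longrightarrow> g \<in> P \<Longrightarrow> le_set f (m f g) = K \<and> le_set g (m f g) = K" by metis
  have "\<exists>H. G \<subseteq> H \<and> H \<subseteq> P \<and> |H| \<le>o cof M \<and> (\<forall>f\<in>H. \<forall>g\<in>H. m f g \<in> H)"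
    by (rule card_of_closure_le[OF co inf \<open>|G| \<le>o cof M\<close> GP m(1)])
  then obtain H where H: "G \<subseteq> H" "H \<subseteq> P" "|H| \<le>o cof M" "\<And>f g. f \<in> H \<Longrightarrow> g \<in> H \<Longrightarrow> m f g \<in> H"
    by metis
  have finite_join: "\<exists>h\<in>H. \<forall>f\<in>A. le_set f h = K" if "finite A" "A \<noteq> {}" "A \<subseteq> H" for A
    using that
  proof (induction A rule: finite_ne_induct)
    case (singleton f)
    then show ?case using le_set_refl H(2) by blast
  next
    case (insert f A)
    then obtain h where h: "h \<in> H" "\<forall>f\<in>A. le_set f h = K" by auto
    have fH: "f \<in> H" using insert.prems by simp
    then have P: "f \<in> P" "h \<in> P" using h(1) H(2) by blast+
    have "le_set g (m f h) = K" if "g \<in> insert f A" for g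
    proof (cases "g = f")
      case False
      then have "le_set g h = K" using h(2) that by simp
      then show ?thesis using le_set_trans[of g h "m f h"] m(2)[OF P] le_set_sub by blast
    qed (use m(2)[OF P] in simp)
    then show ?case using H(4)[OF fH h(1)] by blast
  qed
  have "\<exists>h\<in>H. K - le_set q h \<in> I" if q: "q \<in> P" for q
  proof -
    have "\<exists>B\<in>le_set q ` G. B \<in> D" if D: "ult D" for D
    proof -
      have "cof D \<in> ?S" using D unfolding pcf_iff by blast
      then show ?thesis using F(3)[OF _ D refl q] unfolding G_def by blast
    qed
    then obtain \<F> where "\<F> \<subseteq> le_set q ` G" "finite \<F>" "K - \<Union>\<F> \<in> I"
      using compactness[of K "le_set q ` G"] by blast
    then obtain A where A: "A \<subseteq> G" "finite A" "K - \<Union>(le_set q ` A) \<in> I"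
      using finite_subset_image by metis
    have "A \<noteq> {}" using A(3) ideal_top by auto
    then obtain h where h: "h \<in> H" "\<And>f. f \<in> A \<Longrightarrow> le_set f h = K"
      using finite_join[OF A(2)] A(1) H(1) by blast
    have "le_set q f \<subseteq> le_set q h" if "f \<in> A" for f
      using le_set_trans[of q f h] h(2)[OF that] le_set_sub[of q f] by blast
    then have "K - le_set q h \<subseteq> K - \<Union>(le_set q ` A)" by blast
    then show ?thesis using ideal_mono[OF A(3)] h(1) by blast
  qed
  then have "dominating H (prod_mod K lam I)" using H(2) by (simp add: dominating_prod_iff)
  then show ?thesis using H(3) by blast
qed

theorem cf_is_max_pcf: "is_card_max (pcf K I lam) (cf (prod_mod K lam I))"
proof -
  obtain M where M: "ult M" "\<And>D. ult D \<Longrightarrow> cof D \<le>o cof M" using max_cof by blast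
  obtain X where X: "dominating X (prod_mod K lam I)" "|X| \<le>o cof M"
    using dominating_small[OF M] by blast
  note cand = cf_candidates[OF X(1)]
  obtain Y where Y: "dominating Y (prod_mod K lam I)" "cf (prod_mod K lam I) =o |Y|"
    using cand(4) by blast
  have "cof M \<le>o cf (prod_mod K lam I)"
    using ordLeq_ordIso_trans[OF dominating_ult[OF Y(1) M(1)] ordIso_symmetric[OF Y(2)]] .
  moreover have "cf (prod_mod K lam I) \<le>o cof M" using ordLeq_transitive[OF cand(3) X(2)] .
  ultimately have "cf (prod_mod K lam I) =o cof M" by (simp add: ordIso_iff_ordLeq)
  then have "cf (prod_mod K lam I) = cof M" unfolding cf_def tcf_def
    by (intro card_min_eqI cand(1,2)
        total_quasi_order.scale_lengths[OF ultraproduct_total_quasi_order[OF M(1)]])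
  then show ?thesis unfolding is_card_max_def using M pcf_iff by auto
qed

text \<open>
  An ultrafilter \<open>D\<close> containing \<open>B\<close> must contain \<open>Bs (cof D)\<close>: otherwise the sets outside \<open>D\<close> form an
  ideal that includes \<open>J_less (cof D)\<close> and the generator, hence all of \<open>J_le (cof D)\<close>, against
  \<open>bounding_set\<close>.
\<close>

theorem finite_cover_by_generators:
  assumes gen: "generating_sequence K I lam c Bs" and "B \<subseteq> K" and sub: "pcf_restrict K I lam B \<subseteq> c"
  shows "\<exists>d. finite d \<and> d \<subseteq> c \<and> B - (\<Union>\<mu>\<in>d. Bs \<mu>) \<in> I"
proof -
  have "\<exists>A\<in>Bs ` c. A \<in> D" if D: "ult D" and BD: "B \<in> D" for D
  proof -
    have c: "cof D \<in> c" using sub D BD unfolding pcf_restrict_def ult_def by blast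
    then have BK: "Bs (cof D) \<subseteq> K"
      and J: "J_le K I lam (cof D) = ideal_on K hull (J_less K I lam (cof D) \<union> {Bs (cof D)})"
      using gen unfolding generating_sequence_def by blast+
    have "Bs (cof D) \<in> D"
    proof (rule ccontr)
      assume not: "Bs (cof D) \<notin> D"
      let ?N = "{A. A \<subseteq> K \<and> A \<notin> D}"
      have "A \<union> A' \<in> ?N" if "A \<in> ?N" "A' \<in> ?N" for A A'
      proof -
        have "K - A \<in> D" "K - A' \<in> D" using that ult_compl[OF D] by simp_all
        then have "(K - A) \<inter> (K - A') \<in> D" by (rule ult_Int[OF D])
        moreover have "(K - A) \<inter> (K - A') = K - (A \<union> A')" by blast
        ultimately show ?thesis using that ult_compl[OF D, of "A \<union> A'"] by simp
      qed
      moreover have "{} \<notin> D" using ult_not_I[OF D] ideal_empty by metis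
      moreover have "A' \<in> ?N" if "A \<in> ?N" "A' \<subseteq> A" for A A'
        using that ult_mono[OF D, of A' A] by blast
      ultimately have "ideal_on K ?N" unfolding ideal_on_def by blast
      moreover have "J_less K I lam (cof D) \<subseteq> ?N"
      proof
        fix A assume A: "A \<in> J_less K I lam (cof D)"
        have "cof D \<le>o cof D"
          by (rule ordLeq_reflexive[OF card_order_on_well_order_on[OF cof_Card_order[OF D]]])
        then show "A \<in> ?N" using A D unfolding J_less_def ult_def by blast
      qed
      ultimately have N: "J_le K I lam (cof D) \<subseteq> ?N"
        unfolding J using BK not by (intro hull_minimal) simp_all
      obtain A where A: "A \<in> D" "\<forall>D'. ult D' \<and> A \<in> D' \<longrightarrow> cof D' \<le>o cof D"
        using bounding_set[OF D] by blast
      have "\<not> cardSuc (cof D) \<le>o cof D'" if "ult D'" "A \<in> D'" for D'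
      proof
        assume "cardSuc (cof D) \<le>o cof D'"
        then have "cof D <o cof D'"
          using cardSuc_ordLess_ordLeq[OF cof_Card_order[OF D] cof_Card_order[OF that(1)]] by simp
        then show False using A(2) that not_ordLess_ordLeq by metis
      qed
      then have "A \<in> J_le K I lam (cof D)"
        unfolding J_le_def J_less_def using ult_sub[OF D A(1)] ult_def by blast
      then show False using N A(1) by blast
    qed
    then show ?thesis using c by blast
  qed
  then obtain \<F> where "\<F> \<subseteq> Bs ` c" "finite \<F>" "B - \<Union>\<F> \<in> I"
    using compactness[OF assms(2), of "Bs ` c"] by blast
  then show ?thesis using finite_subset_image by metis
qed

end

section \<open>Saturation, lower limits and the theorem\<close>

text \<open>
  The minimum in the definition of \<open>wsat\<close> is attained, because the parts of a partition are no more
  numerous than the points, so \<open>K\<close> has no partition into as many parts as its type has subsets.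
\<close>

lemma wsat_rules:
  fixes K :: "'k set"
  shows "Card_order (wsat K I)" and "Field (wsat K I) \<noteq> {}"
    and "\<not> (\<exists>Q. partition_on K Q \<and> Q \<subseteq> positive_sets K I \<and> |Q| =o wsat K I)"
proof -
  let ?S = "{\<mu>::'k set rel. Card_order \<mu> \<and> Field \<mu> \<noteq> {} \<and>
    \<not> (\<exists>P. partition_on K P \<and> P \<subseteq> positive_sets K I \<and> |P| =o \<mu>)}"
  have "iso_closed ?S"
  proof -
    have "\<nu> \<in> ?S" if \<mu>: "\<mu> \<in> ?S" and "\<nu> =o \<mu>" for \<mu> \<nu>
    proof -
      have "Field \<nu> \<noteq> {}"
      proof
        assume "Field \<nu> = {}"
        then have "|Field \<mu>| \<le>o |{} :: 'k set set|"
          using card_of_cong[OF \<open>\<nu> =o \<mu>\<close>] ordIso_iff_ordLeq by metis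
        then show False using \<mu> card_of_empty3 by auto
      qed
      then show ?thesis using \<mu> Card_order_ordIso[OF _ \<open>\<nu> =o \<mu>\<close>] ordIso_transitive[OF _ \<open>\<nu> =o \<mu>\<close>] by blast
    qed
    then show ?thesis unfolding iso_closed_def by blast
  qed
  moreover have "|UNIV :: 'k set set| \<in> ?S"
  proof -
    have "False" if Q: "partition_on K Q" "|Q| =o |UNIV :: 'k set set|" for Q
    proof -
      have "\<forall>A\<in>Q. \<exists>x. x \<in> A" using Q(1) unfolding partition_on_def by (metis ex_in_conv)
      then obtain p where p: "\<And>A. A \<in> Q \<Longrightarrow> p A \<in> A" by metis
      have "inj_on p Q"
      proof (rule inj_onI)
        fix A B assume "A \<in> Q" "B \<in> Q" "p A = p B"
        then show "A = B" using p Q(1) unfolding partition_on_def disjoint_def by (metis disjoint_iff)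
      qed
      then have "|Q| \<le>o |UNIV :: 'k set|" by (rule card_of_ordLeqI) simp
      moreover have "|UNIV :: 'k set| <o |UNIV :: 'k set set|" using card_of_Pow[of "UNIV :: 'k set"] by simp
      ultimately have "|Q| <o |UNIV :: 'k set set|" by (rule ordLeq_ordLess_trans)
      then show False using Q(2) not_ordLess_ordIso by blast
    qed
    then show ?thesis by (auto simp: card_of_card_order_on Field_card_of)
  qed
  ultimately have "wsat K I \<in> ?S" using card_min[of ?S] unfolding wsat_def by blast
  then show "Card_order (wsat K I)" "Field (wsat K I) \<noteq> {}"
    "\<not> (\<exists>Q. partition_on K Q \<and> Q \<subseteq> positive_sets K I \<and> |Q| =o wsat K I)" by blast+
qed

text \<open>
  A family of \<open>\<theta>\<close> disjoint positive sets contains one indexed by \<open>wsat K I\<close>, and enlarging one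
  member by everything that is left over turns it into a partition of \<open>K\<close>.
\<close>

lemma no_disjoint_family_of_wsat:
  fixes \<theta> :: "'t rel"
  assumes ideal: "ideal_on K I" and "Card_order \<theta>" and "wsat K I \<le>o \<theta>"
    and A: "\<And>\<xi>. \<xi> \<in> Field \<theta> \<Longrightarrow> A \<xi> \<subseteq> K \<and> A \<xi> \<notin> I" and "disjoint_family_on A (Field \<theta>)"
  shows False
proof -
  let ?w = "wsat K I"
  have "|Field ?w| \<le>o |Field \<theta>|" using card_of_mono2[OF assms(3)] .
  then obtain f where f: "inj_on f (Field ?w)" "f ` Field ?w \<subseteq> Field \<theta>"
    using card_of_ordLeq by metis
  obtain w where w: "w \<in> Field ?w" using wsat_rules(2) by blast
  define C where "C x = (if x = w then K - (\<Union>y\<in>Field ?w - {w}. A (f y)) else A (f x))" for x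
  have fA: "A (f x) \<subseteq> K" "A (f x) \<notin> I" if "x \<in> Field ?w" for x using A f(2) that by blast+
  have dis: "A (f x) \<inter> A (f y) = {}" if "x \<in> Field ?w" "y \<in> Field ?w" "x \<noteq> y" for x y
  proof -
    have "f x \<noteq> f y" using f(1) that by (auto dest: inj_onD)
    then show ?thesis using assms(5) f(2) that unfolding disjoint_family_on_def by blast
  qed
  have "A (f w) \<subseteq> C w" using fA(1)[OF w] dis[OF w] unfolding C_def by auto
  then have "C w \<notin> I" using fA(2)[OF w] ideal unfolding ideal_on_def by blast
  then have pos: "C x \<in> positive_sets K I" if "x \<in> Field ?w" for x
    using fA[OF that] unfolding positive_sets_def C_def by auto
  have Cdis: "C x \<inter> C y = {}" if "x \<in> Field ?w" "y \<in> Field ?w" "x \<noteq> y" for x y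
    using dis[OF that] that unfolding C_def by auto
  have ne: "C x \<noteq> {}" if "x \<in> Field ?w" for x
    using pos[OF that] ideal unfolding positive_sets_def ideal_on_def by auto
  have "\<Union>(C ` Field ?w) = K"
  proof
    show "\<Union>(C ` Field ?w) \<subseteq> K" using pos unfolding positive_sets_def by blast
    show "K \<subseteq> \<Union>(C ` Field ?w)" using w unfolding C_def by auto
  qed
  moreover have "disjoint (C ` Field ?w)"
  proof (rule disjointI)
    fix X Y assume "X \<in> C ` Field ?w" "Y \<in> C ` Field ?w" "X \<noteq> Y"
    then show "X \<inter> Y = {}" using Cdis by auto
  qed
  moreover have "{} \<notin> C ` Field ?w" using ne by force
  ultimately have "partition_on K (C ` Field ?w)" by (simp add: partition_on_def)
  moreover have "C ` Field ?w \<subseteq> positive_sets K I" using pos by blast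
  moreover have "|C ` Field ?w| =o ?w"
  proof -
    have "inj_on C (Field ?w)" using Cdis ne by (metis inf.idem inj_onI)
    then have "|Field ?w| =o |C ` Field ?w|"
      using card_of_ordIso unfolding bij_betw_def by blast
    then show ?thesis
      using ordIso_transitive[OF ordIso_symmetric card_of_Field_ordIso[OF wsat_rules(1)]] by blast
  qed
  ultimately show False using wsat_rules(3) by blast
qed

lemma card_liminf_le:
  fixes lam :: "'k \<Rightarrow> 'a rel" and \<mu> :: "'a rel"
  assumes "proper_ideal_on K I" and "\<And>i. i \<in> K \<Longrightarrow> Card_order (lam i)"
    and "Card_order \<mu>" and "{i\<in>K. lam i \<le>o \<mu>} \<notin> I"
  shows "card_liminf K I lam \<le>o \<mu>"
proof -
  let ?S = "{\<mu>::'a rel. Card_order \<mu> \<and> {i\<in>K. lam i \<le>o \<mu>} \<in> positive_sets K I}"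
  have "\<nu> \<in> ?S" if "\<mu> \<in> ?S" "\<nu> =o \<mu>" for \<mu> \<nu>
  proof -
    have "lam i \<le>o \<nu> \<longleftrightarrow> lam i \<le>o \<mu>" for i
      using ordLeq_ordIso_trans[OF _ that(2)] ordLeq_ordIso_trans[OF _ ordIso_symmetric[OF that(2)]]
      by blast
    then have "{i\<in>K. lam i \<le>o \<nu>} = {i\<in>K. lam i \<le>o \<mu>}" by simp
    then show ?thesis using that Card_order_ordIso by auto
  qed
  then have "iso_closed ?S" unfolding iso_closed_def by blast
  moreover have \<mu>: "\<mu> \<in> ?S" using assms(3,4) unfolding positive_sets_def by blast
  ultimately show ?thesis using card_min[of ?S] unfolding card_liminf_def by blast
qed

lemma small_factors_of_liminf:
  fixes lam :: "'k \<Rightarrow> 'a rel" and S :: "'s set"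
  assumes "proper_ideal_on K I" and "\<And>i. i \<in> K \<Longrightarrow> Card_order (lam i)"
    and less: "|S| <o card_liminf K I lam"
  shows "{i\<in>K. lam i \<le>o |S| } \<in> I"
proof (rule ccontr)
  assume no: "{i\<in>K. lam i \<le>o |S| } \<notin> I"
  obtain T :: "'a set" where T: "|S| =o |T|"
    using internalize_card_of_ordLeq[of S "card_liminf K I lam"] ordLess_imp_ordLeq[OF less] by blast
  have "lam i \<le>o |T| \<longleftrightarrow> lam i \<le>o |S|" for i
    using ordLeq_ordIso_trans[OF _ T] ordLeq_ordIso_trans[OF _ ordIso_symmetric[OF T]] by blast
  then have "{i\<in>K. lam i \<le>o |T| } = {i\<in>K. lam i \<le>o |S| }" by simp
  then have "card_liminf K I lam \<le>o |T|"
    using card_liminf_le[OF assms(1,2) card_of_Card_order[of T]] no by simp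
  then have "card_liminf K I lam \<le>o |S|" using T ordIso_symmetric ordLeq_ordIso_trans by blast
  then show False using less not_ordLess_ordLeq by blast
qed

theorem fact2p10:
  fixes \<kappa> :: "'k rel" and Istar :: "'k set set"
    and lam :: "'k \<Rightarrow> 'a rel" and \<theta> :: "'t rel"
  assumes "Card_order \<kappa>" and "cinfinite \<kappa>"
    and "proper_ideal_on (Field \<kappa>) Istar"
    and "\<And>i. i \<in> Field \<kappa> \<Longrightarrow> Card_order (lam i) \<and> cinfinite (lam i) \<and> regularCard (lam i)"
    and "Card_order \<theta>"
    and "((\<forall>i\<in>Field \<kappa>. \<theta> <o lam i) \<and> wsat (Field \<kappa>) Istar \<le>o \<theta>) \<or>
         (\<theta> \<le>o card_liminf (Field \<kappa>) Istar lam \<and> wsat (Field \<kappa>) Istar \<le>o \<theta> \<and>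
          card_directed (cardSuc \<theta>) (prod_mod (Field \<kappa>) lam Istar))"
  shows "(\<forall>c Bs B. c \<subseteq> pcf (Field \<kappa>) Istar lam \<and>
            generating_sequence (Field \<kappa>) Istar lam c Bs \<and>
            B \<subseteq> Field \<kappa> \<and> pcf_restrict (Field \<kappa>) Istar lam B \<subseteq> c \<longrightarrow>
            (\<exists>d. finite d \<and> d \<subseteq> c \<and> B - (\<Union>\<mu>\<in>d. Bs \<mu>) \<in> Istar)) \<and>
         is_card_max (pcf (Field \<kappa>) Istar lam) (cf (prod_mod (Field \<kappa>) lam Istar))"
proof -
  let ?K = "Field \<kappa>"
  interpret reduced_product ?K Istar lam
    by unfold_locales (fact assms(3), fact assms(4))
  have wsat: "wsat ?K Istar \<le>o \<theta>" using assms(6) by blast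
  have under: "|underS \<theta> \<xi>| <o \<theta>" if "\<xi> \<in> Field \<theta>" for \<xi>
    using card_of_underS[OF assms(5) that] .
  interpret pcf_setting ?K Istar lam \<theta>
  proof
    show "Card_order \<theta>" by (rule assms(5))
    have "|Field (wsat ?K Istar)| \<le>o |Field \<theta>|" using card_of_mono2[OF wsat] .
    then show "Field \<theta> \<noteq> {}" using wsat_rules(2)[of ?K Istar] card_of_empty3 by metis
    show False if "\<And>\<xi>. \<xi> \<in> Field \<theta> \<Longrightarrow> A \<xi> \<subseteq> ?K \<and> A \<xi> \<notin> Istar"
      "disjoint_family_on A (Field \<theta>)" for A
      using no_disjoint_family_of_wsat[OF _ assms(5) wsat that] proper
      unfolding proper_ideal_on_def by blast
  next
    fix A assume A: "A \<subseteq> P" "|A| \<le>o \<theta>"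
    show "\<exists>p\<in>P. \<forall>a\<in>A. ?K - le_set a p \<in> Istar"
      using assms(6)
    proof (elim disjE conjE)
      assume big: "\<forall>i\<in>?K. \<theta> <o lam i"
      obtain g where g: "g \<in> P" "\<forall>i\<in>?K. |A| <o lam i \<longrightarrow> (\<forall>s\<in>A. (s i, g i) \<in> lam i)"
        using pointwise_bound[of A "\<lambda>f. f"] A(1) by blast
      have "le_set a g = ?K" if "a \<in> A" for a
        using g(2) big ordLeq_ordLess_trans[OF A(2)] that unfolding le_set_def by blast
      then show ?thesis using g(1) ideal_empty by (intro bexI[of _ g]) simp_all
    next
      assume dir: "card_directed (cardSuc \<theta>) (prod_mod ?K lam Istar)"
      have "|A| <o cardSuc \<theta>" using ordLeq_ordLess_trans[OF A(2) cardSuc_greater[OF assms(5)]] .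
      then have "\<exists>p\<in>P. \<forall>a\<in>A. (a, p) \<in> prod_mod ?K lam Istar"
        using dir A(1) unfolding card_directed_def Field_prod_mod[OF ideal_empty] by simp
      then show ?thesis by (simp only: prod_mod_iff) blast
    qed
  next
    fix \<xi> assume \<xi>: "\<xi> \<in> Field \<theta>"
    show "{i\<in>?K. lam i \<le>o |underS \<theta> \<xi>| } \<in> Istar"
      using assms(6)
    proof (elim disjE conjE)
      assume big: "\<forall>i\<in>?K. \<theta> <o lam i"
      have "\<not> lam i \<le>o |underS \<theta> \<xi>|" if "i \<in> ?K" for i
        using ordLess_transitive[OF under[OF \<xi>]] big that not_ordLess_ordLeq by blast
      then have "{i\<in>?K. lam i \<le>o |underS \<theta> \<xi>| } = {}" by blast
      then show ?thesis using ideal_empty by (simp only:)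
    next
      assume "\<theta> \<le>o card_liminf ?K Istar lam"
      then have "|underS \<theta> \<xi>| <o card_liminf ?K Istar lam"
        by (rule ordLess_ordLeq_trans[OF under[OF \<xi>]])
      with factors show ?thesis by (intro small_factors_of_liminf[OF assms(3)]) simp_all
    qed
  qed
  show ?thesis using finite_cover_by_generators cf_is_max_pcf by simp
qed

end
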